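(* Let $0<\alpha<1$, $1\le i\le k\le 3$, and $\omega^{(k,i)}(\xi)=\sum_{m\ge0}\omega^{(k,i)}_m\xi^m$ with the weights defined in the context (the series converges absolutely for $|\xi|\le 1$). Then: (i) $\omega^{(k,i)}(\xi)\ne 0$ for all $\xi\in\mathbb{C}$ with $|\xi|\le 1$, $\xi\neq 1$; (ii) $\xi=1$ is a simple zero of $\omega^{(k,i)}$: $\omega^{(k,i)}(1)=0$, and writing $\omega^{(k,i)}(\xi)=(1-\xi)\varphi^{(k,i)}(\xi)$ with $\varphi^{(k,i)}(\xi)=\sum_{n\ge0}\varphi_n\xi^n$, $\varphi_n=\sum_{m=0}^{n}\omega^{(k,i)}_m$, the series $\sum_{n\ge 0}\varphi_n$ does not converge to $0$.
   Context: Uniform grid $t_n=n\Delta t$, $\Delta t>0$, $I_j=[t_{j-1},t_j]$. For a function $u$ and integers $m\ge1$, $j$, $q$, let $p^{m}_{j,q}$ be the polynomial of degree at most $m$ interpolating $u$ at $t_{j+q-m-1},\dots,t_{j+q-1}$. For $1\le i\le k$ and $n\ge k$, let $P^{k}_{i,n}$ be the continuous piecewise polynomial on $[0,t_n]$ equal on $I_j$ to $p^{k-1}_{j,k-j}$ for $1\le j\le k-i$, to $p^{k}_{j,i}$ for $k-i+1\le j\le n-i+1$, and to $p^{k}_{j,n+1-j}$ for $n-i+2\le j\le n$, and set $D^{\alpha}_{k,i}u_n=\frac{1}{\Gamma(1-\alpha)}\int_0^{t_n}(t_n-\xi)^{-\alpha}(P^{k}_{i,n})'(\xi)\,\mathrm{d}\xi$.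 This is a linear combination of $u_0=u(t_0),\dots,u_n=u(t_n)$; for $k\le j\le n$ the coefficient of $u_j$ in $(\Delta t)^{\alpha}D^{\alpha}_{k,i}u_n$ depends only on $n-j$ and is denoted $\omega^{(k,i)}_{n-j}$; this defines $\omega^{(k,i)}_m$ for all $m\ge0$. *)

theory Defs
  imports "HOL-Analysis.Analysis" "HOL-Computational_Algebra.Polynomial"
begin

text \<open>Conventions: the grid step is normalised to Delta t = 1, so t_l = l (the weights
are independent of Delta t). Grid data are given as a function u from node indices to values.\<close>

definition interp_poly :: "(int \<Rightarrow> real) \<Rightarrow> nat \<Rightarrow> int \<Rightarrow> int \<Rightarrow> real poly" where
  "interp_poly u m j q =
     (let s = j + q - int m - 1 in
      (\<Sum>a\<in>{0..m}. smult (u (s + int a) / (\<Prod>b\<in>{0..m} - {a}. (real a - real b)))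
                          (\<Prod>b\<in>{0..m} - {a}. [:- real_of_int (s + int b), 1:])))"

text \<open>The piece of P^k_{i,n} on the interval I_j = [t_(j-1), t_j], 1 <= j <= n.\<close>
definition piece_poly :: "(int \<Rightarrow> real) \<Rightarrow> nat \<Rightarrow> nat \<Rightarrow> nat \<Rightarrow> nat \<Rightarrow> real poly" where
  "piece_poly u k i n j =
     (if int j \<le> int k - int i then interp_poly u (k - 1) (int j) (int k - int j)
      else if int j \<le> int n - int i + 1 then interp_poly u k (int j) (int i)
      else interp_poly u k (int j) (int n + 1 - int j))"

definition frac_D :: "real \<Rightarrow> nat \<Rightarrow> nat \<Rightarrow> (int \<Rightarrow> real) \<Rightarrow> nat \<Rightarrow> real" where
  "frac_D \<alpha> k i u n =
     (1 / Gamma (1 - \<alpha>)) *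
     (\<Sum>j\<in>{1..n}. integral {real j - 1 .. real j}
        (\<lambda>\<xi>. (real n - \<xi>) powr (- \<alpha>) * poly (pderiv (piece_poly u k i n j)) \<xi>))"

text \<open>The weight omega^{(k,i)}_m: the coefficient of u_j in (Delta t)^alpha D u_n
with n - j = m, taken at j = k, n = m + k (coefficient = value of D on the unit grid
function at node j).\<close>
definition weight :: "real \<Rightarrow> nat \<Rightarrow> nat \<Rightarrow> nat \<Rightarrow> real" where
  "weight \<alpha> k i m = frac_D \<alpha> k i (\<lambda>l. if l = int k then 1 else 0) (m + k)"

definition weight_gf :: "real \<Rightarrow> nat \<Rightarrow> nat \<Rightarrow> complex \<Rightarrow> complex" where
  "weight_gf \<alpha> k i \<xi> = (\<Sum>m. complex_of_real (weight \<alpha> k i m) * \<xi> ^ m)"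

end

theory Submission
  imports Defs "HOL-Complex_Analysis.Conformal_Mappings"
begin

text \<open>
  Write \<open>\<omega>(\<xi>) = (1 - \<xi>) \<phi>(\<xi>)\<close>. Everything follows from a bound \<open>Re \<phi>(\<xi>) \<ge> \<delta> > 0\<close>, uniform in \<open>|\<xi>| < 1\<close>:
  continuity of \<open>\<omega>\<close> on the closed disc extends it to the boundary points \<open>\<xi> \<noteq> 1\<close>, and by Abel's theorem it is
  incompatible with \<open>\<Sum>\<phi>\<^sub>n = 0\<close>.

  Inserting \<open>\<Gamma>(\<alpha>) y\<^bsup>-\<alpha>\<^esup> = \<integral>\<^sub>0\<^sup>\<infinity> t\<^bsup>\<alpha>-1\<^esup> e\<^bsup>-ty\<^esup> dt\<close> and summing the geometric series turns \<open>\<phi>\<close> into an average over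
  \<open>t > 0\<close> of rational functions of \<open>\<xi>\<close>. With \<open>z = 1 - \<xi>\<close> and \<open>q = e\<^bsup>-t\<^esup>\<close> these have the form
  \<open>(A + B z + C z\<^sup>2 + E z\<^sup>3) / (1 - q \<xi>)\<close>, where, for \<open>k = 3\<close>, \<open>A, B, C\<close> are integrals of \<open>e\<^bsup>-tx\<^esup>\<close> against \<open>1\<close>, \<open>1/2 - x\<close> and
  \<open>1/3 - x + x\<^sup>2/2\<close> over \<open>[0, 1]\<close>. Monotonicity of the weight yields \<open>B \<ge> 0\<close>, \<open>0 \<le> 3 C \<le> A\<close> and \<open>0 \<le> E \<le> q C\<close>, and then the
  real part is at least \<open>A / 12\<close> on the unit circle, hence on the disc by the maximum principle.
\<close>

section \<open>Exponential moments on the unit interval\<close>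

definition exp_moment :: "real \<Rightarrow> real poly \<Rightarrow> real" where
  "exp_moment t p = integral {0..1} (\<lambda>x. exp (- t * x) * poly p x)"

lemma exp_moment_integrable: "(\<lambda>x. exp (- t * x) * poly p x) integrable_on {0..1::real}"
  by (intro integrable_continuous_real continuous_intros)

lemma exp_moment_add: "exp_moment t (p + q) = exp_moment t p + exp_moment t q"
  unfolding exp_moment_def poly_add distrib_left
  by (intro Henstock_Kurzweil_Integration.integral_add exp_moment_integrable)

lemma exp_moment_smult: "exp_moment t (smult c p) = c * exp_moment t p"
  unfolding exp_moment_def by (simp add: mult.left_commute[of _ c])

lemma exp_moment_minus: "exp_moment t (- p) = - exp_moment t p"
  unfolding exp_moment_def by simp

lemma exp_moment_mono:
  assumes "\<And>x. 0 \<le> x \<Longrightarrow> x \<le> 1 \<Longrightarrow> poly p x \<le> poly q x"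
  shows "exp_moment t p \<le> exp_moment t q"
  unfolding exp_moment_def
  by (intro integral_le exp_moment_integrable mult_left_mono assms) auto

lemma exp_moment_quadratic: "exp_moment t [:a, b, c:] = a * exp_moment t 1 + b * exp_moment t [:0, 1:] + c * exp_moment t [:0, 0, 1:]"
proof -
  have "[:a, b, c:] = smult a 1 + smult b [:0, 1:] + smult c [:0, 0, 1:]"
    by simp
  then show ?thesis
    by (simp only: exp_moment_add exp_moment_smult)
qed

lemma exp_moment_linear: "exp_moment t [:a, b:] = a * exp_moment t 1 + b * exp_moment t [:0, 1:]"
  using exp_moment_quadratic[of t a b 0] by simp

lemma exp_moment_const: "exp_moment t [:a:] = a * exp_moment t 1"
  using exp_moment_linear[of t a 0] by simp

lemma exp_moment_1_pos: "0 < exp_moment t 1"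
proof -
  have "exp (- \<bar>t\<bar>) \<le> exp_moment t 1"
  proof -
    have "integral {0..1} (\<lambda>x::real. exp (- \<bar>t\<bar>)) \<le> exp_moment t 1"
      unfolding exp_moment_def
    proof (intro integral_le exp_moment_integrable)
      fix x :: real assume "x \<in> {0..1}"
      then have "t * x \<le> \<bar>t\<bar>"
        by (metis abs_ge_self abs_mult abs_of_nonneg atLeastAtMost_iff mult_left_le order_trans abs_ge_zero)
      then show "exp (- \<bar>t\<bar>) \<le> exp (- t * x) * poly 1 x"
        by simp
    qed auto
    then show ?thesis by simp
  qed
  then show ?thesis
    by (smt (verit) exp_gt_zero)
qed

section \<open>Inequalities from mean-zero polynomials against monotone weights\<close>

lemma integral_quadratic_01:
  "integral {0..1::real} (poly [:a, b, c:]) = a + b / 2 + c / 3"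
proof -
  have "((\<lambda>x. poly [:a, b, c:] x) has_integral
      ((\<lambda>x. a * x + b * x ^ 2 / 2 + c * x ^ 3 / 3) 1 - (\<lambda>x. a * x + b * x ^ 2 / 2 + c * x ^ 3 / 3) 0)) {0..1::real}"
    by (intro fundamental_theorem_of_calculus)
      (auto simp flip: has_real_derivative_iff_has_vector_derivative
        intro!: derivative_eq_intros simp: algebra_simps power2_eq_square)
  then show ?thesis by (auto dest: integral_unique simp del: poly_pCons)
qed

text \<open>As \<open>p\<close> has mean zero, \<open>w\<close> may be replaced by
  \<open>w x - w c\<close>. This factor and \<open>p\<close> are both nonnegative left of
  \<open>c\<close> and both nonpositive right of it, so their product is nonnegative
  throughout.\<close>

lemma integral_single_sign_change_nonneg:
  fixes w :: "real \<Rightarrow> real"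
  assumes w: "continuous_on {0..1} w" "antimono_on {0..1} w"
    and p: "integral {0..1} (poly p) = 0"
    and c: "c \<in> {0..1}"
    and pos: "\<And>x. 0 \<le> x \<Longrightarrow> x \<le> c \<Longrightarrow> 0 \<le> poly p x"
    and neg: "\<And>x. c \<le> x \<Longrightarrow> x \<le> 1 \<Longrightarrow> poly p x \<le> 0"
  shows "0 \<le> integral {0..1} (\<lambda>x. w x * poly p x)"
proof -
  have "0 = integral {0..1} (\<lambda>x. w c * poly p x)"
    using p by simp
  also have "\<dots> \<le> integral {0..1} (\<lambda>x. w x * poly p x)"
  proof (intro integral_le integrable_continuous_real continuous_intros w)
    fix x :: real assume x: "x \<in> {0..1}"
    show "w c * poly p x \<le> w x * poly p x"
    proof (cases "x \<le> c")
      case True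
      then show ?thesis
        using x c w(2) pos[of x] by (intro mult_right_mono) (auto simp: monotone_on_def)
    next
      case False
      then show ?thesis
        using x c w(2) neg[of x] by (intro mult_right_mono_neg) (auto simp: monotone_on_def)
    qed
  qed
  finally show ?thesis .
qed

lemma exp_moment_single_sign_change_nonneg:
  assumes "0 \<le> t" "integral {0..1} (poly p) = 0" "c \<in> {0..1}"
    and "\<And>x. 0 \<le> x \<Longrightarrow> x \<le> c \<Longrightarrow> 0 \<le> poly p x"
    and "\<And>x. c \<le> x \<Longrightarrow> x \<le> 1 \<Longrightarrow> poly p x \<le> 0"
  shows "0 \<le> exp_moment t p"
  unfolding exp_moment_def using assms
  by (intro integral_single_sign_change_nonneg[where c = c] continuous_intros monotone_onI)
    (auto intro: mult_left_mono)

lemma exp_moment_half_minus_nonneg: "0 \<le> t \<Longrightarrow> 0 \<le> exp_moment t [:1/2, -1:]"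
  by (rule exp_moment_single_sign_change_nonneg[where c = "1/2"])
    (use integral_quadratic_01[of "1/2" "-1" 0] in auto)

lemma inverse_sqrt_3: "1 / sqrt 3 \<in> {0..1::real}" "(1 / sqrt 3) ^ 2 = (1 / 3 :: real)"
  by (auto simp: power_divide)

lemma exp_moment_third_minus_nonneg: "0 \<le> t \<Longrightarrow> 0 \<le> exp_moment t [:1/3, -1, 1/2:]"
proof (rule exp_moment_single_sign_change_nonneg[where c = "1 - 1 / sqrt 3"])
  show "integral {0..1} (poly [:1/3, -1, 1/2::real:]) = 0"
    unfolding integral_quadratic_01 by simp
  show "1 - 1 / sqrt 3 \<in> {0..1::real}" using inverse_sqrt_3(1) by auto
  \<comment> \<open>Completing the square exhibits 1 - 1/sqrt 3 as the only root in [0, 1], hence as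
    the point of sign change.\<close>
  have eq: "poly [:1/3, -1, 1/2:] x = ((1 - x)^2 - (1 / sqrt 3)^2) / 2" for x :: real
    unfolding inverse_sqrt_3(2) by (simp add: field_simps power2_eq_square)
  show "0 \<le> poly [:1/3, -1, 1/2:] x" if "0 \<le> x" "x \<le> 1 - 1 / sqrt 3" for x :: real
    unfolding eq using that power_mono[of "1 / sqrt 3" "1 - x" 2] by auto
  show "poly [:1/3, -1, 1/2:] x \<le> 0" if "1 - 1 / sqrt 3 \<le> x" "x \<le> 1" for x :: real
    unfolding eq using that power_mono[of "1 - x" "1 / sqrt 3" 2] by auto
qed

text \<open>Up to sign this polynomial is the image of 1/3 - x + x^2/2 under x -> 1 - x, so its sign
  changes at 1/sqrt 3. The link is exploited in
  \<open>exp_times_moment_sixth_minus_le\<close>.\<close>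

lemma sixth_minus_eq: "poly [:1/6, 0, -1/2:] x = ((1 / sqrt 3)^2 - x^2) / (2::real)"
  unfolding inverse_sqrt_3(2) by (simp add: field_simps power2_eq_square)

lemma integral_sixth_minus: "integral {0..1} (poly [:1/6, 0, -1/2::real:]) = 0"
  unfolding integral_quadratic_01 by simp

lemma sixth_minus_nonneg: "0 \<le> x \<Longrightarrow> x \<le> 1 / sqrt 3 \<Longrightarrow> 0 \<le> poly [:1/6, 0, -1/2:] (x::real)"
  unfolding sixth_minus_eq using power_mono[of x "1 / sqrt 3" 2] by simp

lemma sixth_minus_nonpos: "1 / sqrt 3 \<le> x \<Longrightarrow> poly [:1/6, 0, -1/2:] (x::real) \<le> 0"
  unfolding sixth_minus_eq using power_mono[of "1 / sqrt 3" x 2] by simp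

lemma exp_moment_sixth_minus_nonneg: "0 \<le> t \<Longrightarrow> 0 \<le> exp_moment t [:1/6, 0, -1/2:]"
  by (rule exp_moment_single_sign_change_nonneg[where c = "1 / sqrt 3"])
    (use inverse_sqrt_3(1) integral_sixth_minus sixth_minus_nonneg sixth_minus_nonpos in auto)

lemma exp_moment_reflect: "exp_moment t p = exp (- t) * exp_moment (- t) (p \<circ>\<^sub>p [:1, -1:])"
proof -
  have "exp_moment t p = integral {0..1} (\<lambda>x. exp (- t * (1 - x)) * poly p (1 - x))"
  proof -
    have "((\<lambda>x. exp (- t * x) * poly p x) has_integral exp_moment t p) (cbox 0 1)"
      using exp_moment_integrable[of t p] by (simp add: exp_moment_def has_integral_iff)
    from has_integral_affinity[OF this, of "-1" 1] show ?thesis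
      by (simp add: has_integral_iff image_affinity_atLeastAtMost algebra_simps)
  qed
  also have "\<dots> = exp (- t) * exp_moment (- t) (p \<circ>\<^sub>p [:1, -1:])"
    unfolding exp_moment_def
    by (simp add: poly_pcompose right_diff_distrib exp_diff exp_minus field_simps exp_add
        flip: integral_mult_right)
  finally show ?thesis .
qed

text \<open>Reflecting the first integral turns the claim into
  \<open>\<integral>\<^sub>0\<^sup>1 cosh (t x) (1/6 - x\<^sup>2/2) dx \<le> 0\<close>.\<close>
lemma exp_times_moment_sixth_minus_le:
  assumes "0 \<le> t"
  shows "exp (- t) * exp_moment t [:1/6, 0, -1/2:] \<le> exp_moment t [:1/3, -1, 1/2:]"
proof -
  let ?D = "[:1/6, 0, -1/2::real:]"
  have "antimono_on {0..1} (\<lambda>x. - (exp (t * x) + exp (- t * x)))"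
  proof (rule monotone_onI)
    fix x y :: real assume xy: "x \<in> {0..1}" "y \<in> {0..1}" "x \<le> y"
    have "cosh (t * x) \<le> cosh (t * y)"
      using xy assms by (subst cosh_real_nonneg_le_iff) (auto intro: mult_left_mono)
    then show "- (exp (t * y) + exp (- t * y)) \<le> - (exp (t * x) + exp (- t * x))"
      by (simp add: cosh_def)
  qed
  then have "0 \<le> integral {0..1} (\<lambda>x. - (exp (t * x) + exp (- t * x)) * poly ?D x)"
    by (intro integral_single_sign_change_nonneg[where c = "1 / sqrt 3"] continuous_intros
        integral_sixth_minus sixth_minus_nonneg sixth_minus_nonpos inverse_sqrt_3(1)) auto
  also have "\<dots> = - (exp_moment (- t) ?D + exp_moment t ?D)"
    unfolding exp_moment_def
    by (subst Henstock_Kurzweil_Integration.integral_add[symmetric])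
      (use exp_moment_integrable[of t ?D] exp_moment_integrable[of "- t" ?D] in
        \<open>simp_all only: minus_minus distrib_right mult_minus_left Henstock_Kurzweil_Integration.integral_neg\<close>)
  finally have "exp_moment t ?D \<le> exp_moment (- t) (- ?D)"
    by (simp only: exp_moment_minus)
  moreover have "exp_moment t [:1/3, -1, 1/2:] = exp (- t) * exp_moment (- t) (- ?D)"
    by (subst exp_moment_reflect) (simp add: pcompose_pCons)
  ultimately show ?thesis by simp
qed

text \<open>Pointwise 1 - 3x + 3x^2/2 <= 1 on [0, 1], because x^2 <= x. For k = 3 this lets the
  constant coefficient of the cubic absorb negative contributions of the higher ones.\<close>

lemma three_times_moment_third_minus_le: "3 * exp_moment t [:1/3, -1, 1/2:] \<le> exp_moment t 1"
proof -
  have "exp_moment t (smult 3 [:1/3, -1, 1/2:]) \<le> exp_moment t 1"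
  proof (rule exp_moment_mono)
    fix x :: real assume "0 \<le> x" "x \<le> 1"
    then have "x * x \<le> x * 1" by (intro mult_left_mono)
    then show "poly (smult 3 [:1/3, -1, 1/2:]) x \<le> poly 1 x"
      using \<open>0 \<le> x\<close> by (simp add: algebra_simps)
  qed
  then show ?thesis by (simp only: exp_moment_smult)
qed

section \<open>Cubics divided by \<open>1 - q \<xi>\<close>\<close>

text \<open>On the unit circle z + cnj z and z * cnj z both equal 2u. Hence z^2 = 2u z - 2u, the
  cubic collapses to a + b z with real a and b depending on u, and the real part can be read
  off.\<close>

lemma Re_cubic_cnj:
  fixes A B C E q u :: real and \<xi> z :: complex
  assumes "cmod \<xi> = 1"
  defines "z \<equiv> 1 - \<xi>" and "u \<equiv> 1 - Re \<xi>"
  shows "Re ((A + B * z + C * z^2 + E * z^3) * cnj (1 - q * \<xi>)) =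
    A * ((1 - q) + q * u) + B * (u * (1 + q)) + C * (2 * u^2 - 2 * u * (1 - q))
      + E * (4 * u^3 - 6 * u^2 + 2 * q * u^2)"
    and "(cmod (1 - q * \<xi>))^2 = (1 - q)^2 + 2 * q * u"
proof -
  have zz: "z * cnj z = of_real (2 * u)"
  proof -
    have "(Re \<xi>)^2 + (Im \<xi>)^2 = 1"
      using assms(1) by (simp flip: cmod_power2)
    then show ?thesis
      by (simp add: complex_eq_iff z_def u_def power2_eq_square algebra_simps)
  qed
  have Rez: "Re z = u" and zc: "cnj z = of_real (2 * u) - z" and zs: "z + cnj z = of_real (2 * u)"
    by (auto simp: z_def u_def complex_eq_iff)
  have z2: "z^2 = of_real (2 * u) * z - of_real (2 * u)"
    using zz unfolding zc by (simp add: algebra_simps power2_eq_square)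
  have z3: "z^3 = of_real (4 * u^2 - 2 * u) * z - of_real (4 * u^2)"
  proof -
    have "z^3 = z * z^2" by (simp add: power3_eq_cube power2_eq_square)
    also have "\<dots> = of_real (2 * u) * z^2 - of_real (2 * u) * z"
      using arg_cong[OF z2, of "(*) z"] by (simp add: algebra_simps power2_eq_square)
    finally show ?thesis unfolding z2 by (simp add: algebra_simps power2_eq_square)
  qed
  define a where "a = A - 2 * u * C - 4 * u^2 * E"
  define b where "b = B + 2 * u * C + (4 * u^2 - 2 * u) * E"
  have N: "A + B * z + C * z^2 + E * z^3 = of_real a + of_real b * z"
    unfolding z2 z3 a_def b_def by (simp add: algebra_simps)
  have W: "1 - q * \<xi> = of_real (1 - q) + of_real q * z"
    by (simp add: z_def algebra_simps)
  have "(of_real a + of_real b * z) * cnj (1 - q * \<xi>)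
     = of_real (a * (1 - q)) + of_real (a * q) * cnj z + of_real (b * (1 - q)) * z + of_real (b * q) * (z * cnj z)"
    unfolding W by (simp add: algebra_simps)
  also have "Re \<dots> = a * (1 - q) + a * q * u + b * (1 - q) * u + b * q * (2 * u)"
    unfolding zz by (simp add: Rez)
  finally show "Re ((A + B * z + C * z^2 + E * z^3) * cnj (1 - q * \<xi>)) =
    A * ((1 - q) + q * u) + B * (u * (1 + q)) + C * (2 * u^2 - 2 * u * (1 - q))
      + E * (4 * u^3 - 6 * u^2 + 2 * q * u^2)"
    unfolding N a_def b_def by (simp add: algebra_simps power2_eq_square power3_eq_cube)
  have "of_real ((cmod (1 - q * \<xi>))^2) = (1 - q * \<xi>) * cnj (1 - q * \<xi>)"
    by (simp only: complex_norm_square)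
  also have "\<dots> = of_real ((1 - q)^2) + of_real (q * (1 - q)) * (z + cnj z) + of_real (q^2) * (z * cnj z)"
    unfolding W by (simp add: algebra_simps power2_eq_square)
  also have "\<dots> = of_real ((1 - q)^2 + 2 * q * u)"
    unfolding zz zs by (simp add: algebra_simps power2_eq_square)
  finally show "(cmod (1 - q * \<xi>))^2 = (1 - q)^2 + 2 * q * u"
    by (simp only: of_real_eq_iff)
qed

text \<open>Multiplying by the conjugate denominator turns the claim into
  \<open>A * (W / 12) <= X\<close>. One sixth of the A-term of \<open>X\<close> pays for the left
  side. The negative parts of the C- and E-terms are absorbed by the other five sixths under the
  first alternative of \<open>AC\<close>, and by the B-term under the second.\<close>

lemma Re_cubic_div_circle:
  fixes A B C E q :: real and \<xi> :: complex
  assumes \<xi>: "cmod \<xi> = 1" and q: "0 \<le> q" "q < 1"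
    and A: "0 \<le> A" and B: "0 \<le> B" and C: "0 \<le> C" and E: "0 \<le> E" "E \<le> q * C"
    and AC: "3 * C \<le> A \<or> E = 0 \<and> C \<le> q * B"
  shows "A / 12 \<le> Re ((A + B * (1 - \<xi>) + C * (1 - \<xi>)^2 + E * (1 - \<xi>)^3) / (1 - q * \<xi>))"
proof -
  define u where "u = 1 - Re \<xi>"
  have u: "0 \<le> u" using \<xi> complex_Re_le_cmod[of \<xi>] by (simp add: u_def)
  define X where "X = A * ((1 - q) + q * u) + B * (u * (1 + q)) + C * (2 * u^2 - 2 * u * (1 - q))
      + E * (4 * u^3 - 6 * u^2 + 2 * q * u^2)"
  define W where "W = (1 - q)^2 + 2 * q * u"
  have "1 - q * \<xi> \<noteq> 0"
  proof
    assume "1 - q * \<xi> = 0"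
    then have "cmod (q * \<xi>) = 1" by simp
    then show False using \<xi> q by (simp add: norm_mult)
  qed
  then have Wpos: "0 < W"
    using Re_cubic_cnj(2)[OF \<xi>, of q] by (metis W_def u_def zero_less_norm_iff zero_less_power)
  have W_le: "W / 12 \<le> ((1 - q) + q * u) / 6"
  proof -
    have "(1 - q)^2 \<le> (1 - q) * 1" unfolding power2_eq_square using q by (intro mult_left_mono) auto
    then show ?thesis using q by (simp add: W_def)
  qed
  have "A * (W / 12) \<le> X"
  proof -
    have "A * (W / 12) \<le> A * (((1 - q) + q * u) / 6)"
      by (rule mult_left_mono[OF W_le A])
    moreover have "0 \<le> 5/6 * A * ((1 - q) + q * u) + B * (u * (1 + q)) + C * (2 * u^2 - 2 * u * (1 - q))
      + E * (4 * u^3 - 6 * u^2 + 2 * q * u^2)"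
      using AC
    proof
      assume "3 * C \<le> A"
      then have 1: "5/6 * (3 * C) * ((1 - q) + q * u) \<le> 5/6 * A * ((1 - q) + q * u)"
        using q u by (intro mult_right_mono mult_left_mono) auto
      \<comment> \<open>The constant 9/4 completes the square: 4u^3 - 6u^2 + (9/4)u = u(2u -
        3/2)^2.\<close>
      have "0 \<le> u * (2 * u - 3/2)^2 + 2 * q * u^2"
        using u q by simp
      then have "- (9/4 * u) \<le> 4 * u^3 - 6 * u^2 + 2 * q * u^2"
        by (simp add: power2_eq_square power3_eq_cube algebra_simps)
      then have "E * (- (9/4 * u)) \<le> E * (4 * u^3 - 6 * u^2 + 2 * q * u^2)"
        using E(1) by (rule mult_left_mono)
      moreover have "E * (9/4 * u) \<le> q * C * (9/4 * u)"
        using E(2) u by (intro mult_right_mono) auto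
      ultimately have 2: "- (q * C * (9/4 * u)) \<le> E * (4 * u^3 - 6 * u^2 + 2 * q * u^2)" by simp
      \<comment> \<open>After \<open>3 * C <= A\<close> and \<open>E <= q * C\<close> have been
        applied, only a multiple of \<open>C\<close> is left. Splitting 2u^2 as (1 - q) 2u^2 + 2q
        u^2 and completing the square in u shows that its factor is nonnegative.\<close>
      have "0 \<le> C * ((1 - q) * (2 * (u - 1/2)^2 + 2) + 1/4 * (q * u) + 2 * q * u^2)"
        using q u C by (intro mult_nonneg_nonneg add_nonneg_nonneg) auto
      also have "\<dots> = 5/6 * (3 * C) * ((1 - q) + q * u) + C * (2 * u^2 - 2 * u * (1 - q)) - q * C * (9/4 * u)"
        by (simp add: field_simps power2_eq_square)
      finally show ?thesis
        using 1 2 mult_nonneg_nonneg[OF B, of "u * (1 + q)"] u q by simp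
    next
      assume EC: "E = 0 \<and> C \<le> q * B"
      have "C * (2 * u * (1 - q)) \<le> q * B * (2 * u * (1 - q))"
        using EC u q by (intro mult_right_mono) auto
      also have "\<dots> \<le> B * (u * (1 + q))"
      proof -
        have "0 \<le> B * u * ((1 - q) + 2 * q^2)" using B u q by simp
        then show ?thesis by (simp add: algebra_simps power2_eq_square)
      qed
      finally have "C * (2 * u * (1 - q)) \<le> B * (u * (1 + q))" .
      moreover have "0 \<le> A * ((1 - q) + q * u)" "0 \<le> C * u^2"
        using A C q u by simp_all
      ultimately show ?thesis
        using EC by (simp add: right_diff_distrib)
    qed
    ultimately show ?thesis unfolding X_def by (simp add: field_simps)
  qed
  then have "A / 12 \<le> X / W" using Wpos by (simp add: field_simps)
  also have "\<dots> = Re ((A + B * (1 - \<xi>) + C * (1 - \<xi>)^2 + E * (1 - \<xi>)^3) / (1 - q * \<xi>))"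
    unfolding complex_div_cnj[of _ "1 - q * \<xi>"]
    using Re_cubic_cnj(1)[OF \<xi>, of A B C E q] Re_cubic_cnj(2)[OF \<xi>, of q]
    by (simp add: X_def W_def u_def del: complex_cnj_diff)
  finally show ?thesis .
qed

lemma Re_cubic_div_disc:
  fixes A B C E q :: real and \<xi> :: complex
  assumes \<xi>: "cmod \<xi> \<le> 1" and q: "0 \<le> q" "q < 1"
    and A: "0 \<le> A" and B: "0 \<le> B" and C: "0 \<le> C" and E: "0 \<le> E" "E \<le> q * C"
    and AC: "3 * C \<le> A \<or> E = 0 \<and> C \<le> q * B"
  shows "A / 12 \<le> Re ((A + B * (1 - \<xi>) + C * (1 - \<xi>)^2 + E * (1 - \<xi>)^3) / (1 - q * \<xi>))"
proof -
  \<comment> \<open>The quotient is negated because the maximum principle bounds real parts from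
    above. As q < 1, the pole lies outside the closed disc.\<close>
  let ?f = "\<lambda>\<xi>::complex. - ((A + B * (1 - \<xi>) + C * (1 - \<xi>)^2 + E * (1 - \<xi>)^3) / (1 - q * \<xi>))"
  have nz: "1 - q * \<xi> \<noteq> 0" if "cmod \<xi> \<le> 1" for \<xi> :: complex
  proof
    assume "1 - q * \<xi> = 0"
    then have "cmod (q * \<xi>) = 1" by simp
    moreover have "cmod (q * \<xi>) \<le> q * 1" unfolding norm_mult using that q by (intro mult_mono) auto
    ultimately show False using q by simp
  qed
  have "Re (?f \<xi>) \<le> - (A / 12)"
  proof (rule maximum_real_frontier[where S = "cball 0 1" and f = ?f])
    show "?f holomorphic_on interior (cball 0 1)"
      using nz by (intro holomorphic_intros) auto
    show "continuous_on (closure (cball 0 1)) ?f"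
      using nz by (intro continuous_intros) auto
    show "Re (?f \<xi>) \<le> - (A / 12)" if "\<xi> \<in> frontier (cball 0 1)" for \<xi>
      using Re_cubic_div_circle[OF _ q A B C E AC, of \<xi>] that by (simp add: frontier_cball)
  qed (use \<xi> in auto)
  then show ?thesis by simp
qed

section \<open>Fractional moments as Laplace averages\<close>

text \<open>The measure is left unnormalised, which is where the factor
  \<open>Gamma \<alpha>\<close> in the later averages comes from.\<close>

definition laplace_measure :: "real \<Rightarrow> real measure" where
  "laplace_measure \<alpha> = density lborel (\<lambda>t. ennreal (indicator {0<..} t * t powr (\<alpha> - 1)))"

lemma sets_laplace_measure [measurable_cong, simp]: "sets (laplace_measure \<alpha>) = sets borel"
  by (simp add: laplace_measure_def)

lemma sigma_finite_laplace_measure: "sigma_finite_measure (laplace_measure \<alpha>)"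
  unfolding laplace_measure_def by (subst sigma_finite_measure.sigma_finite_iff_density_finite[OF sigma_finite_lborel]) auto

lemma AE_laplace_measure_pos: "AE t in laplace_measure \<alpha>. 0 < t"
  unfolding laplace_measure_def by (subst AE_density) (auto simp: indicator_def)

text \<open>Euler's integral for Gamma under the substitution t -> y t. The factor
  \<open>y powr (1 - \<alpha>)\<close> cancels the power of y that the substitution takes out of the
  density.\<close>

lemma has_bochner_integral_laplace_measure_exp:
  assumes "0 < \<alpha>" "0 < y"
  shows "has_bochner_integral (laplace_measure \<alpha>) (\<lambda>t. exp (- t * y)) (Gamma \<alpha> * y powr (- \<alpha>))"
proof -
  have Gpos: "0 < Gamma \<alpha>" using assms by (simp add: Gamma_real_pos)
  have "has_bochner_integral lborel (\<lambda>t. indicator {0..} t * t powr (\<alpha> - 1) / exp t) (Gamma \<alpha>)"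
    using Gamma_conv_nn_integral_real[OF assms(1)] Gpos
    by (intro has_bochner_integral_nn_integral) auto
  then have "has_bochner_integral lborel
      (\<lambda>t. indicator {0..} (0 + y * t) * (0 + y * t) powr (\<alpha> - 1) / exp (0 + y * t)) (Gamma \<alpha> /\<^sub>R \<bar>y\<bar>)"
    using assms by (subst (asm) lborel_has_bochner_integral_real_affine_iff[where c = y and t = 0]) auto
  then have "has_bochner_integral lborel
      (\<lambda>t. y powr (1 - \<alpha>) * (indicator {0..} (0 + y * t) * (0 + y * t) powr (\<alpha> - 1) / exp (0 + y * t)))
      (y powr (1 - \<alpha>) * (Gamma \<alpha> /\<^sub>R \<bar>y\<bar>))"
    by (intro has_bochner_integral_mult_right)
  also have "(\<lambda>t. y powr (1 - \<alpha>) * (indicator {0..} (0 + y * t) * (0 + y * t) powr (\<alpha> - 1) / exp (0 + y * t)))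
     = (\<lambda>t. (indicator {0<..} t * t powr (\<alpha> - 1)) *\<^sub>R exp (- t * y))"
  proof (rule ext)
    fix t :: real
    show "y powr (1 - \<alpha>) * (indicator {0..} (0 + y * t) * (0 + y * t) powr (\<alpha> - 1) / exp (0 + y * t))
       = (indicator {0<..} t * t powr (\<alpha> - 1)) *\<^sub>R exp (- t * y)"
    proof (cases "0 < t")
      case True
      have "y powr (1 - \<alpha>) * (y powr (\<alpha> - 1)) = 1"
        using assms by (simp flip: powr_add)
      then show ?thesis
        using True assms by (simp add: powr_mult exp_minus field_simps)
    next
      case False
      then show ?thesis using assms by (cases "t = 0") (auto simp: indicator_def zero_le_mult_iff)
    qed
  qed
  also have "y powr (1 - \<alpha>) * (Gamma \<alpha> /\<^sub>R \<bar>y\<bar>) = Gamma \<alpha> * y powr (- \<alpha>)"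
    using assms by (simp add: powr_diff powr_minus field_simps)
  finally show ?thesis
    unfolding laplace_measure_def by (intro has_bochner_integral_density) auto
qed

text \<open>Here \<open>r\<close> counts the cells between the current cell and the end point t_n,
  and \<open>x\<close> runs backwards from the right end of the cell. The kernel is singular only
  for r = 0, at x = 0.\<close>

definition powr_moment :: "real \<Rightarrow> nat \<Rightarrow> real poly \<Rightarrow> real" where
  "powr_moment \<alpha> r p = integral {0..1} (\<lambda>x. (real r + x) powr (- \<alpha>) * poly p x)"

lemma borel_measurable_poly [measurable]: "poly (p :: real poly) \<in> borel_measurable borel"
  by (intro borel_measurable_continuous_onI continuous_intros)

lemma poly_bounded_01:
  obtains K :: real where "0 \<le> K" "\<And>x. 0 \<le> x \<Longrightarrow> x \<le> 1 \<Longrightarrow> \<bar>poly p x\<bar> \<le> K"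
proof -
  have "compact (poly p ` {0..1::real})"
    by (intro compact_continuous_image continuous_intros) auto
  then obtain K where "\<forall>y \<in> poly p ` {0..1}. norm y \<le> K"
    using bounded_iff compact_imp_bounded by blast
  then show ?thesis
    by (intro that[of K]) (force intro: order_trans[OF abs_ge_zero])+
qed

lemma set_integrable_powr_01:
  assumes "0 < \<alpha>" "\<alpha> < 1"
  shows "set_integrable lborel {0..1} (\<lambda>x::real. x powr (- \<alpha>))"
proof -
  have "(\<lambda>x::real. x powr (- \<alpha>)) absolutely_integrable_on {0..1}"
    using assms by (intro nonnegative_absolutely_integrable_1 integrable_on_powr_from_0) auto
  then show ?thesis
    unfolding set_integrable_def by (subst (asm) integrable_completion) auto
qed

lemma set_integrable_powr_moment:
  assumes "0 < \<alpha>" "\<alpha> < 1"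
  shows "set_integrable lborel {0..1} (\<lambda>x. (real r + x) powr (- \<alpha>) * poly p x)"
proof -
  obtain K where K: "0 \<le> K" "\<And>x. 0 \<le> x \<Longrightarrow> x \<le> 1 \<Longrightarrow> \<bar>poly p x\<bar> \<le> K"
    using poly_bounded_01[of p] by blast
  have 1: "set_integrable lborel {0..1} (\<lambda>x::real. x powr (- \<alpha>) * K)"
    using set_integrable_powr_01[OF assms] by simp
  \<comment> \<open>At x = 0 the majorant is 0, since 0 raised by \<open>powr\<close> is 0, so the
    bound can fail there when r > 0.\<close>
  have "AE x in lborel. x \<noteq> (0::real)"
    by (rule AE_lborel_singleton)
  then have "AE x in lborel. x \<in> {0..1} \<longrightarrow>
      norm ((real r + x) powr (- \<alpha>) * poly p x) \<le> norm (x powr (- \<alpha>) * K)"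
  proof eventually_elim
    case (elim x)
    show ?case
    proof
      assume "x \<in> {0..1}"
      then have "(real r + x) powr (- \<alpha>) * \<bar>poly p x\<bar> \<le> x powr (- \<alpha>) * K"
        using elim assms K by (intro mult_mono powr_mono2') auto
      then show "norm ((real r + x) powr (- \<alpha>) * poly p x) \<le> norm (x powr (- \<alpha>) * K)"
        using K(1) by (simp add: abs_mult)
    qed
  qed
  then show ?thesis
    by (intro set_integrable_bound[OF 1]) (auto simp: set_borel_measurable_def)
qed

lemmas powr_moment_integrable = set_borel_integral_eq_integral(1)[OF set_integrable_powr_moment]

lemma powr_moment_lebesgue:
  assumes "0 < \<alpha>" "\<alpha> < 1"
  shows "powr_moment \<alpha> r p = (\<integral>x. indicator {0..1} x * ((real r + x) powr (- \<alpha>) * poly p x) \<partial>lborel)"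
  using set_borel_integral_eq_integral(2)[OF set_integrable_powr_moment[OF assms, of r p]]
  by (simp add: powr_moment_def set_lebesgue_integral_def)

text \<open>Fubini for exp(-t(r + x)) p(x): integrating over t first gives the power kernel times
  \<open>Gamma \<alpha>\<close>, integrating over x first gives the exponential moment. Absolute
  integrability on the product reduces to \<open>set_integrable_powr_moment\<close>.\<close>

lemma
  assumes \<alpha>: "0 < \<alpha>" "\<alpha> < 1"
  shows integrable_exp_times_exp_moment: "integrable (laplace_measure \<alpha>) (\<lambda>t. exp (- t * real r) * exp_moment t p)"
    and powr_moment_laplace: "(\<integral>t. exp (- t * real r) * exp_moment t p \<partial>laplace_measure \<alpha>) = Gamma \<alpha> * powr_moment \<alpha> r p"
proof -
  interpret M: sigma_finite_measure "laplace_measure \<alpha>"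
    by (rule sigma_finite_laplace_measure)
  interpret P: pair_sigma_finite lborel "laplace_measure \<alpha>" ..
  let ?f = "\<lambda>x t::real. indicator {0..1} x * (exp (- t * (real r + x)) * poly p x)"
  \<comment> \<open>For r = 0 the point x = 0 would put y = 0 into the Laplace formula, which
    requires y > 0.\<close>
  have ae: "AE x in lborel. x \<noteq> (0::real)"
    by (rule AE_lborel_singleton)
  have inner: "has_bochner_integral (laplace_measure \<alpha>) (\<lambda>t. ?f x t)
      (indicator {0..1} x * (Gamma \<alpha> * (real r + x) powr (- \<alpha>) * poly p x))"
    and inner_norm: "has_bochner_integral (laplace_measure \<alpha>) (\<lambda>t. norm (?f x t))
      (indicator {0..1} x * (Gamma \<alpha> * (real r + x) powr (- \<alpha>) * \<bar>poly p x\<bar>))" if "x \<noteq> 0" for x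
  proof -
    have *: "has_bochner_integral (laplace_measure \<alpha>) (\<lambda>t. exp (- t * (real r + x)))
        (Gamma \<alpha> * (real r + x) powr (- \<alpha>))" if "x \<in> {0..1}"
      using that \<open>x \<noteq> 0\<close> by (intro has_bochner_integral_laplace_measure_exp \<alpha>) auto
    show "has_bochner_integral (laplace_measure \<alpha>) (\<lambda>t. ?f x t)
      (indicator {0..1} x * (Gamma \<alpha> * (real r + x) powr (- \<alpha>) * poly p x))"
      by (cases "x \<in> {0..1}") (use * in \<open>auto intro!: has_bochner_integral_mult_left\<close>)
    show "has_bochner_integral (laplace_measure \<alpha>) (\<lambda>t. norm (?f x t))
      (indicator {0..1} x * (Gamma \<alpha> * (real r + x) powr (- \<alpha>) * \<bar>poly p x\<bar>))"
      by (cases "x \<in> {0..1}") (use * in \<open>auto simp: abs_mult intro!: has_bochner_integral_mult_left\<close>)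
  qed
  have meas [measurable]: "case_prod ?f \<in> borel_measurable (lborel \<Otimes>\<^sub>M laplace_measure \<alpha>)"
    by measurable
  have int: "integrable (lborel \<Otimes>\<^sub>M laplace_measure \<alpha>) (case_prod ?f)"
  proof (rule P.Fubini_integrable)
    have i1: "integrable lborel (\<lambda>x. Gamma \<alpha> * norm (indicator {0..1} x * ((real r + x) powr (- \<alpha>) * poly p x)))"
      using set_integrable_powr_moment[OF \<alpha>, of r p]
      by (intro integrable_mult_right integrable_norm) (simp add: set_integrable_def)
    have "AE x in lborel. (\<integral>t. norm (case (x, t) of (x, t) \<Rightarrow> ?f x t) \<partial>laplace_measure \<alpha>)
        = Gamma \<alpha> * norm (indicator {0..1} x * ((real r + x) powr (- \<alpha>) * poly p x))"
      using ae
    proof eventually_elim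
      case (elim x)
      show ?case
        using has_bochner_integral_integral_eq[OF inner_norm[OF elim]] by (simp add: abs_mult)
    qed
    then show "integrable lborel (\<lambda>x. \<integral>t. norm (case (x, t) of (x, t) \<Rightarrow> ?f x t) \<partial>laplace_measure \<alpha>)"
      by (subst integrable_cong_AE[OF _ _ ]) (use i1 in auto)
    show "AE x in lborel. integrable (laplace_measure \<alpha>) (\<lambda>t. case (x, t) of (x, t) \<Rightarrow> ?f x t)"
      using ae by eventually_elim (use inner in \<open>auto simp: has_bochner_integral_iff\<close>)
  qed (fact meas)
  have inner2: "(\<integral>x. ?f x t \<partial>lborel) = exp (- t * real r) * exp_moment t p" for t
  proof -
    have "set_integrable lborel {0..1} (\<lambda>x. exp (- t * (real r + x)) * poly p x)"
      by (intro borel_integrable_atLeastAtMost' continuous_intros)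
    from set_borel_integral_eq_integral(2)[OF this]
    have "(\<integral>x. ?f x t \<partial>lborel) = integral {0..1} (\<lambda>x. exp (- t * (real r + x)) * poly p x)"
      by (simp add: set_lebesgue_integral_def)
    also have "\<dots> = exp (- t * real r) * exp_moment t p"
      unfolding exp_moment_def integral_mult_right[symmetric]
      by (simp add: distrib_left exp_diff exp_minus field_simps exp_add)
    finally show ?thesis .
  qed
  show "integrable (laplace_measure \<alpha>) (\<lambda>t. exp (- t * real r) * exp_moment t p)"
    using P.integrable_snd[OF int] by (simp only: inner2)
  have "(\<integral>t. exp (- t * real r) * exp_moment t p \<partial>laplace_measure \<alpha>) = (\<integral>x. (\<integral>t. ?f x t \<partial>laplace_measure \<alpha>) \<partial>lborel)"
    using P.Fubini_integral[OF int] by (simp only: inner2)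
  also have "\<dots> = (\<integral>x. Gamma \<alpha> * (indicator {0..1} x * ((real r + x) powr (- \<alpha>) * poly p x)) \<partial>lborel)"
  proof (rule integral_cong_AE)
    show "AE x in lborel. (\<integral>t. ?f x t \<partial>laplace_measure \<alpha>)
      = Gamma \<alpha> * (indicator {0..1} x * ((real r + x) powr (- \<alpha>) * poly p x))"
      using ae
    proof eventually_elim
      case (elim x)
      show ?case
        using has_bochner_integral_integral_eq[OF inner[OF elim]] by simp
    qed
  qed measurable
  also have "\<dots> = Gamma \<alpha> * powr_moment \<alpha> r p"
    by (simp add: powr_moment_lebesgue[OF \<alpha>])
  finally show "(\<integral>t. exp (- t * real r) * exp_moment t p \<partial>laplace_measure \<alpha>) = Gamma \<alpha> * powr_moment \<alpha> r p" .
qed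

lemma integral_cell_eq_powr_moment:
  assumes \<alpha>: "0 < \<alpha>" "\<alpha> < 1" and "j \<le> n"
    and p: "\<And>x. poly P (real j - x) = poly p x"
  shows "integral {real j - 1..real j} (\<lambda>x. (real n - x) powr (- \<alpha>) * poly P x) = powr_moment \<alpha> (n - j) p"
proof -
  have "((\<lambda>x. (real (n - j) + x) powr (- \<alpha>) * poly p x) has_integral powr_moment \<alpha> (n - j) p) (cbox 0 1)"
    using powr_moment_integrable[OF \<alpha>, of "n - j" p] by (simp add: powr_moment_def has_integral_iff)
  from has_integral_affinity[OF this, of "-1" "real j"] show ?thesis
    using \<open>j \<le> n\<close> p[of "real j - _"]
    by (simp add: has_integral_iff image_affinity_atLeastAtMost algebra_simps of_nat_diff)
qed

lemma powr_moment_add: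
  assumes "0 < \<alpha>" "\<alpha> < 1"
  shows "powr_moment \<alpha> r (p + q) = powr_moment \<alpha> r p + powr_moment \<alpha> r q"
  unfolding powr_moment_def poly_add distrib_left
  by (intro Henstock_Kurzweil_Integration.integral_add powr_moment_integrable assms)

lemma powr_moment_sum:
  assumes "0 < \<alpha>" "\<alpha> < 1"
  shows "powr_moment \<alpha> r (\<Sum>i\<in>I. p i) = (\<Sum>i\<in>I. powr_moment \<alpha> r (p i))"
proof (induction I rule: infinite_finite_induct)
  case (insert i I)
  then show ?case by (simp add: powr_moment_add[OF assms])
qed (auto simp: powr_moment_def)

section \<open>Decay and bounded variation of the fractional moments\<close>

lemma powr_moment_1_bounds:
  assumes "0 < \<alpha>" "\<alpha> < 1" "0 < r"
  shows "0 \<le> powr_moment \<alpha> r 1" "powr_moment \<alpha> r 1 \<le> real r powr (- \<alpha>)"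
proof -
  show "0 \<le> powr_moment \<alpha> r 1"
    unfolding powr_moment_def by (intro integral_nonneg powr_moment_integrable assms) auto
  have "powr_moment \<alpha> r 1 \<le> integral {0..1} (\<lambda>x::real. real r powr (- \<alpha>))"
    unfolding powr_moment_def
  proof (rule integral_le[OF powr_moment_integrable])
    fix x :: real assume "x \<in> {0..1}"
    then show "(real r + x) powr - \<alpha> * poly 1 x \<le> real r powr - \<alpha>"
      using assms by (auto intro!: powr_mono2')
  qed (use assms in auto)
  then show "powr_moment \<alpha> r 1 \<le> real r powr (- \<alpha>)" by simp
qed

lemma powr_moment_1_tendsto_0:
  assumes "0 < \<alpha>" "\<alpha> < 1"
  shows "(\<lambda>r. powr_moment \<alpha> r 1) \<longlonglongrightarrow> 0"
proof (rule tendsto_sandwich[where f = "\<lambda>_. 0" and h = "\<lambda>r. real r powr (- \<alpha>)"])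
  show "(\<lambda>r. real r powr (- \<alpha>)) \<longlonglongrightarrow> 0"
    using assms by (intro tendsto_neg_powr filterlim_real_sequentially) auto
  show "\<forall>\<^sub>F r in sequentially. 0 \<le> powr_moment \<alpha> r 1"
    "\<forall>\<^sub>F r in sequentially. powr_moment \<alpha> r 1 \<le> real r powr - \<alpha>"
    using powr_moment_1_bounds[OF assms] by (auto simp: eventually_sequentially intro!: exI[of _ 1])
qed auto

lemma powr_moment_0_1_pos:
  assumes "0 < \<alpha>" "\<alpha> < 1"
  shows "0 < powr_moment \<alpha> 0 1"
  using has_integral_powr_from_0[of "- \<alpha>" 1] assms by (simp add: powr_moment_def has_integral_iff)

text \<open>A bound for \<open>p\<close> on [0, 1] reduces both claims to p = 1. There the kernel
  decreases in r, so the differences have constant sign and telescope. Bounded variation is the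
  substitute for absolute summability of the moments themselves, which fails for p = 1.\<close>

lemma
  assumes \<alpha>: "0 < \<alpha>" "\<alpha> < 1"
  shows powr_moment_tendsto_0: "(\<lambda>r. powr_moment \<alpha> r p) \<longlonglongrightarrow> 0"
    and powr_moment_bounded_variation: "summable (\<lambda>r. \<bar>powr_moment \<alpha> (Suc r) p - powr_moment \<alpha> r p\<bar>)"
proof -
  obtain K where K: "0 \<le> K" "\<And>x. 0 \<le> x \<Longrightarrow> x \<le> 1 \<Longrightarrow> \<bar>poly p x\<bar> \<le> K"
    using poly_bounded_01[of p] by blast
  note int = powr_moment_integrable[OF \<alpha>]
  have "\<bar>powr_moment \<alpha> r p\<bar> \<le> K * powr_moment \<alpha> r 1" for r
  proof -
    have "\<bar>powr_moment \<alpha> r p\<bar> \<le> integral {0..1} (\<lambda>x. K * ((real r + x) powr (- \<alpha>) * poly 1 x))"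
      unfolding powr_moment_def real_norm_def[symmetric]
    proof (rule integral_norm_bound_integral[OF int integrable_on_mult_right[OF int]])
      fix x :: real assume "x \<in> {0..1}"
      then show "norm ((real r + x) powr - \<alpha> * poly p x) \<le> K * ((real r + x) powr - \<alpha> * poly 1 x)"
        using K(2)[of x] by (simp add: abs_mult mult.commute[of K] mult_left_mono)
    qed
    then show ?thesis by (simp add: powr_moment_def)
  qed
  moreover have "(\<lambda>r. K * powr_moment \<alpha> r 1) \<longlonglongrightarrow> 0"
    using tendsto_mult_left[OF powr_moment_1_tendsto_0[OF \<alpha>], of K] by simp
  ultimately show "(\<lambda>r. powr_moment \<alpha> r p) \<longlonglongrightarrow> 0"
    by (intro Lim_null_comparison[of "\<lambda>r. powr_moment \<alpha> r p" "\<lambda>r. K * powr_moment \<alpha> r 1"]) auto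
  \<comment> \<open>The case r = 0 is left out because 0 raised by \<open>powr\<close> is 0, which
    breaks the monotonicity of the kernel at x = 0. Summability is unaffected by one term.\<close>
  have diff: "\<bar>powr_moment \<alpha> (Suc r) p - powr_moment \<alpha> r p\<bar> \<le> K * (powr_moment \<alpha> r 1 - powr_moment \<alpha> (Suc r) 1)"
    if "0 < r" for r
  proof -
    let ?h = "\<lambda>r x. (real r + x) powr (- \<alpha>)"
    have "\<bar>powr_moment \<alpha> (Suc r) p - powr_moment \<alpha> r p\<bar>
        = norm (integral {0..1} (\<lambda>x. ?h (Suc r) x * poly p x - ?h r x * poly p x))"
      unfolding powr_moment_def by (subst Henstock_Kurzweil_Integration.integral_diff[OF int int]) auto
    also have "\<dots> \<le> integral {0..1} (\<lambda>x. K * (?h r x * poly 1 x - ?h (Suc r) x * poly 1 x))"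
    proof (intro integral_norm_bound_integral integrable_on_mult_right integrable_diff int)
      fix x :: real assume x: "x \<in> {0..1}"
      have "?h (Suc r) x \<le> ?h r x"
        using x that \<alpha> by (intro powr_mono2') auto
      then have "\<bar>?h (Suc r) x - ?h r x\<bar> * \<bar>poly p x\<bar> \<le> (?h r x - ?h (Suc r) x) * K"
        using K x by (intro mult_mono) auto
      then show "norm (?h (Suc r) x * poly p x - ?h r x * poly p x) \<le> K * (?h r x * poly 1 x - ?h (Suc r) x * poly 1 x)"
        by (simp add: mult.commute[of K] abs_mult flip: left_diff_distrib)
    qed
    also have "\<dots> = K * (powr_moment \<alpha> r 1 - powr_moment \<alpha> (Suc r) 1)"
      unfolding powr_moment_def integral_mult_right
      by (subst Henstock_Kurzweil_Integration.integral_diff[OF int int]) auto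
    finally show ?thesis .
  qed
  have "summable (\<lambda>r. K * (powr_moment \<alpha> r 1 - powr_moment \<alpha> (Suc r) 1))"
    by (intro summable_mult telescope_summable'[OF powr_moment_1_tendsto_0[OF \<alpha>]])
  then show "summable (\<lambda>r. \<bar>powr_moment \<alpha> (Suc r) p - powr_moment \<alpha> r p\<bar>)"
    by (rule summable_comparison_test'[where N = 1]) (unfold real_norm_def abs_abs, rule diff, linarith)
qed

section \<open>The weights as fractional moments of Lagrange polynomials\<close>

definition lagrange :: "nat \<Rightarrow> nat \<Rightarrow> real poly" where
  "lagrange k p = (\<Prod>b\<in>{0..k} - {p}. smult (1 / (real p - real b)) [:- real b, 1:])"

text \<open>In the reversed coordinate \<open>n - x\<close> the coefficient of \<open>u\<^bsub>n-p\<^esub>\<close> in the interpolant is \<open>lagrange k p\<close>,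
  up to a shift by \<open>c\<close>; the sign comes from the reversal.\<close>
definition lagrange_slope :: "nat \<Rightarrow> nat \<Rightarrow> nat \<Rightarrow> real poly" where
  "lagrange_slope k p c = - (pderiv (lagrange k p) \<circ>\<^sub>p [:real c, 1:])"

text \<open>\<open>interp_poly\<close> numbers the nodes of the stencil from the left,
  \<open>lagrange\<close> from the right. Factor b of one therefore matches factor k - b of the
  other, with sign changes that cancel between numerator and denominator.\<close>

lemma interp_poly_unit:
  assumes p: "p \<le> k" and l: "l = j + q - 1 - int p"
  shows "interp_poly (\<lambda>l'. if l' = l then 1 else 0) k j q = lagrange k p \<circ>\<^sub>p [:of_int (j + q - 1), -1:]"
proof -
  define s where "s = j + q - int k - 1"
  have "poly (interp_poly (\<lambda>l'. if l' = l then 1 else 0) k j q) x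
      = poly (lagrange k p \<circ>\<^sub>p [:of_int (j + q - 1), -1:]) x" for x
  proof -
    have eq: "s + int a = l \<longleftrightarrow> a = k - p" if "a \<in> {0..k}" for a
      using that p by (auto simp: l s_def)
    have "poly (interp_poly (\<lambda>l'. if l' = l then 1 else 0) k j q) x
      = (\<Sum>a\<in>{0..k}. if a = k - p then
          (1 / (\<Prod>b\<in>{0..k} - {a}. (real a - real b))) * (\<Prod>b\<in>{0..k} - {a}. (x - real_of_int (s + int b))) else 0)"
      unfolding interp_poly_def Let_def s_def[symmetric] poly_sum
      by (intro sum.cong refl) (auto simp: eq poly_prod simp del: of_int_add)
    also have "\<dots> = (\<Prod>b\<in>{0..k} - {k - p}. (x - real_of_int (s + int b)) / (real (k - p) - real b))"
      by (simp add: prod_dividef)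
    also have "\<dots> = (\<Prod>b\<in>{0..k} - {p}. (1 / (real p - real b)) * ((real_of_int (j + q - 1) - x) - real b))"
    proof (rule prod.reindex_bij_witness[of _ "\<lambda>b. k - b" "\<lambda>b. k - b"])
      fix b assume b: "b \<in> {0..k} - {k - p}"
      then have "real p \<noteq> real (k - b)" using p by auto
      then show "1 / (real p - real (k - b)) * (real_of_int (j + q - 1) - x - real (k - b)) =
          (x - real_of_int (s + int b)) / (real (k - p) - real b)"
        using b p by (simp add: s_def of_nat_diff divide_simps) (simp add: algebra_simps)
    qed (use p in auto)
    also have "\<dots> = poly (lagrange k p \<circ>\<^sub>p [:of_int (j + q - 1), -1:]) x"
      unfolding lagrange_def poly_pcompose poly_prod by (intro prod.cong) (simp_all add: diff_divide_distrib add_divide_distrib)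
    finally show ?thesis .
  qed
  then show ?thesis by (intro iffD1[OF poly_eq_poly_eq_iff] ext)
qed

lemma interp_poly_unit_outside:
  assumes "l < j + q - int k - 1 \<or> j + q - 1 < l"
  shows "interp_poly (\<lambda>l'. if l' = l then 1 else 0) k j q = 0"
  unfolding interp_poly_def Let_def using assms by (intro sum.neutral) auto

lemma integral_cell_lagrange:
  assumes \<alpha>: "0 < \<alpha>" "\<alpha> < 1" and "j \<le> n" and b: "b = int j + int c"
  shows "integral {real j - 1..real j}
      (\<lambda>x. (real n - x) powr (- \<alpha>) * poly (pderiv (lagrange k p \<circ>\<^sub>p [:of_int b, -1:])) x)
    = powr_moment \<alpha> (n - j) (lagrange_slope k p c)"
  by (rule integral_cell_eq_powr_moment[OF \<alpha> \<open>j \<le> n\<close>])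
    (simp add: lagrange_slope_def pderiv_pcompose poly_pcompose pderiv_pCons b algebra_simps)

text \<open>The unit datum sits at node k and n = m + k. The first sum comes from the cells with the
  regular stencil, the second from the last i - 1 cells, where the stencil is frozen.\<close>

lemma weight_eq_powr_moment:
  assumes \<alpha>: "0 < \<alpha>" "\<alpha> < 1" and i: "1 \<le> i" "i \<le> k"
  shows "Gamma (1 - \<alpha>) * weight \<alpha> k i m =
    (\<Sum>p\<le>k. if p \<le> m then powr_moment \<alpha> (m - p + (i - 1)) (lagrange_slope k p (i - 1)) else 0)
    + (if m \<le> k then \<Sum>c<i - 1. powr_moment \<alpha> c (lagrange_slope k m c) else 0)"
proof -
  define n where "n = m + k"
  define u where "u = (\<lambda>l. if l = int k then 1 else 0 :: real)"
  define cell where "cell j = integral {real j - 1..real j}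
    (\<lambda>x. (real n - x) powr (- \<alpha>) * poly (pderiv (piece_poly u k i n j)) x)" for j
  have "i \<le> n" using i by (simp add: n_def)
  have "0 < Gamma (1 - \<alpha>)" using \<alpha> by (intro Gamma_real_pos) simp
  then have "Gamma (1 - \<alpha>) * weight \<alpha> k i m = (\<Sum>j\<in>{1..n}. cell j)"
    by (simp add: weight_def frac_D_def n_def u_def cell_def)
  also have "{1..n} = {1..k-i} \<union> ({k-i+1..n-i+1} \<union> {n-i+2..n})"
    using i by (auto simp: n_def)
  also have "(\<Sum>j\<in>\<dots>. cell j) = (\<Sum>j\<in>{1..k-i}. cell j) + ((\<Sum>j\<in>{k-i+1..n-i+1}. cell j) + (\<Sum>j\<in>{n-i+2..n}. cell j))"
  proof -
    have d: "{k-i+1..n-i+1} \<inter> {n-i+2..n} = {}" "{1..k-i} \<inter> ({k-i+1..n-i+1} \<union> {n-i+2..n}) = {}"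
      using i by (auto simp: n_def)
    show ?thesis
      using sum.union_disjoint[OF _ _ d(2), of cell] sum.union_disjoint[OF _ _ d(1), of cell] by simp
  qed
  \<comment> \<open>The initial cells interpolate at the nodes 0, ..., k - 1, which miss node
    k.\<close>
  also have "(\<Sum>j\<in>{1..k-i}. cell j) = 0"
  proof (rule sum.neutral, safe)
    fix j assume j: "j \<in> {1..k-i}"
    have "piece_poly u k i n j = 0"
      using j i unfolding piece_poly_def u_def by (subst interp_poly_unit_outside) auto
    then show "cell j = 0" by (simp add: cell_def)
  qed
  \<comment> \<open>The index p is the position of node k counted back from the right end j + i - 1
    of the stencil of cell j.\<close>
  also have "(\<Sum>j\<in>{k-i+1..n-i+1}. cell j)
     = (\<Sum>p\<le>m. if p \<le> k then powr_moment \<alpha> (m - p + (i - 1)) (lagrange_slope k p (i - 1)) else 0)"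
  proof (rule sum.reindex_bij_witness[of _ "\<lambda>p. k - i + 1 + p" "\<lambda>j. j - (k - i + 1)"])
    fix j assume j: "j \<in> {k-i+1..n-i+1}"
    define p where "p = j - (k - i + 1)"
    have piece: "piece_poly u k i n j = interp_poly u k (int j) (int i)"
      using j i by (auto simp: piece_poly_def n_def)
    show "(if p \<le> k then powr_moment \<alpha> (m - p + (i - 1)) (lagrange_slope k p (i - 1)) else 0) = cell j"
    proof (cases "p \<le> k")
      case True
      have "piece_poly u k i n j = lagrange k p \<circ>\<^sub>p [:of_int (int j + int i - 1), -1:]"
        unfolding piece unfolding u_def using j i by (intro interp_poly_unit True) (auto simp: p_def)
      moreover have "n - j = m - p + (i - 1)" "j \<le> n"
        using j i True by (auto simp: n_def p_def)
      ultimately show ?thesis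
        unfolding cell_def using True i
        by (simp only:) (subst integral_cell_lagrange[OF \<alpha>, where c = "i - 1"], auto)
    next
      case False
      have "piece_poly u k i n j = 0"
        unfolding piece unfolding u_def using j i False by (intro interp_poly_unit_outside) (auto simp: p_def)
      then show ?thesis using False by (simp add: cell_def)
    qed
  qed (use i in \<open>auto simp: n_def\<close>)
  also have "\<dots> = (\<Sum>p\<le>k. if p \<le> m then powr_moment \<alpha> (m - p + (i - 1)) (lagrange_slope k p (i - 1)) else 0)"
    by (rule sum.mono_neutral_cong) auto
  \<comment> \<open>Here every cell uses the nodes n - k, ..., n. Node k has position m from the
    right, so it belongs to the stencil exactly when m <= k. The index c is n - j.\<close>
  also have "(\<Sum>j\<in>{n-i+2..n}. cell j) = (if m \<le> k then \<Sum>c<i - 1. powr_moment \<alpha> c (lagrange_slope k m c) else 0)"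
  proof -
    have piece: "piece_poly u k i n j = interp_poly u k (int j) (int n + 1 - int j)" if "j \<in> {n-i+2..n}" for j
      using that i by (auto simp: piece_poly_def n_def)
    show ?thesis
    proof (cases "m \<le> k")
      case True
      have "(\<Sum>j\<in>{n-i+2..n}. cell j) = (\<Sum>c<i - 1. powr_moment \<alpha> c (lagrange_slope k m c))"
      proof (rule sum.reindex_bij_witness[of _ "\<lambda>c. n - c" "\<lambda>j. n - j"])
        fix j assume j: "j \<in> {n-i+2..n}"
        have "piece_poly u k i n j = lagrange k m \<circ>\<^sub>p [:of_int (int j + (int n + 1 - int j) - 1), -1:]"
          unfolding piece[OF j] unfolding u_def by (intro interp_poly_unit True) (auto simp: n_def)
        then have "piece_poly u k i n j = lagrange k m \<circ>\<^sub>p [:of_int (int n), -1:]"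
          by simp
        then show "powr_moment \<alpha> (n - j) (lagrange_slope k m (n - j)) = cell j"
          unfolding cell_def using j by (simp only:) (subst integral_cell_lagrange[OF \<alpha>, where c = "n - j"], auto)
      qed (use i \<open>i \<le> n\<close> in auto)
      then show ?thesis using True by simp
    next
      case False
      have "cell j = 0" if j: "j \<in> {n-i+2..n}" for j
      proof -
        have "piece_poly u k i n j = 0"
          unfolding piece[OF j] unfolding u_def using False by (intro interp_poly_unit_outside) (auto simp: n_def)
        then show ?thesis by (simp add: cell_def)
      qed
      then show ?thesis using False by simp
    qed
  qed
  finally show ?thesis by (simp only: add_0)
qed

section \<open>The generating function\<close>

text \<open>Under the Laplace representation r enters only through exp(-t r), so the series in r is
  geometric with ratio \<xi> exp(-t). The majorant \<open>\<bar>g t\<bar> * cmod \<xi> ^ r\<close>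
  justifies exchanging sum and integral.\<close>

lemma powr_moment_gf:
  assumes \<alpha>: "0 < \<alpha>" "\<alpha> < 1" and \<xi>: "cmod \<xi> < 1"
  shows "\<exists>S. (\<lambda>r. of_real (powr_moment \<alpha> (r + c) p) * \<xi> ^ r) sums S \<and>
    has_bochner_integral (laplace_measure \<alpha>)
      (\<lambda>t. of_real (exp (- t * real c) * exp_moment t p) / (1 - \<xi> * of_real (exp (- t)))) (of_real (Gamma \<alpha>) * S)"
proof -
  let ?M = "laplace_measure \<alpha>"
  define g where "g t = exp (- t * real c) * exp_moment t p" for t
  define f where "f r t = of_real (exp (- t * real (r + c)) * exp_moment t p) * \<xi> ^ r" for r t
  have Gpos: "0 < Gamma \<alpha>" using \<alpha> by (simp add: Gamma_real_pos)
  have f_eq: "f r t = of_real (g t) * (\<xi> * of_real (exp (- t))) ^ r" for r t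
    by (simp add: f_def g_def power_mult_distrib ring_distribs exp_diff exp_minus field_simps
        flip: of_real_power exp_of_nat_mult)
  have int_f: "integrable ?M (f r)" for r
    unfolding f_def by (intro integrable_mult_left integrable_of_real integrable_exp_times_exp_moment \<alpha>)
  have int_g: "integrable ?M g"
    unfolding g_def by (intro integrable_exp_times_exp_moment \<alpha>)
  have small: "cmod (\<xi> * of_real (exp (- t))) \<le> cmod \<xi>" if "0 < t" for t
    using that by (simp add: norm_mult mult_left_le)
  have bound: "norm (f r t) \<le> \<bar>g t\<bar> * cmod \<xi> ^ r" if "0 < t" for r t
  proof -
    have "norm (f r t) = \<bar>g t\<bar> * cmod (\<xi> * of_real (exp (- t))) ^ r"
      unfolding f_eq by (simp add: norm_mult norm_power)
    also have "\<dots> \<le> \<bar>g t\<bar> * cmod \<xi> ^ r"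
      using small[OF that] by (intro mult_left_mono power_mono) auto
    finally show ?thesis .
  qed
  have sum1: "AE t in ?M. summable (\<lambda>r. norm (f r t))"
    using AE_laplace_measure_pos
  proof eventually_elim
    case (elim t)
    have "summable (\<lambda>r. \<bar>g t\<bar> * cmod \<xi> ^ r)"
      using \<xi> by (intro summable_mult summable_geometric) simp
    then show ?case
      by (rule summable_comparison_test'[where N = 0]) (use bound[OF elim] in simp)
  qed
  have "summable (\<lambda>r. (\<integral>t. \<bar>g t\<bar> \<partial>?M) * cmod \<xi> ^ r)"
    using \<xi> by (intro summable_mult summable_geometric) simp
  then have sum2: "summable (\<lambda>r. \<integral>t. norm (f r t) \<partial>?M)"
  proof (rule summable_comparison_test'[where N = 0])
    fix r
    have "(\<integral>t. norm (f r t) \<partial>?M) \<le> (\<integral>t. \<bar>g t\<bar> * cmod \<xi> ^ r \<partial>?M)"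
      using AE_laplace_measure_pos[of \<alpha>]
      by (intro integral_mono_AE integrable_norm integrable_mult_left integrable_abs int_f int_g)
        (auto elim!: eventually_mono intro: bound)
    also have "\<dots> = (\<integral>t. \<bar>g t\<bar> \<partial>?M) * cmod \<xi> ^ r" by simp
    finally show "norm (\<integral>t. norm (f r t) \<partial>?M) \<le> (\<integral>t. \<bar>g t\<bar> \<partial>?M) * cmod \<xi> ^ r"
      by (simp add: abs_of_nonneg[OF integral_nonneg])
  qed
  note sums = sums_integral[OF int_f sum1 sum2] and int = integrable_suminf[OF int_f sum1 sum2]
  have lim: "AE t in ?M. (\<Sum>r. f r t) = of_real (g t) / (1 - \<xi> * of_real (exp (- t)))"
    using AE_laplace_measure_pos
  proof eventually_elim
    case (elim t)
    have "cmod (\<xi> * of_real (exp (- t))) < 1"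
      using small[OF elim] \<xi> by linarith
    from sums_mult[OF geometric_sums[OF this], of "of_real (g t)"]
    show ?case unfolding f_eq by (simp add: sums_iff)
  qed
  have meas: "(\<lambda>t. \<Sum>r. f r t) \<in> borel_measurable ?M"
    "(\<lambda>t. of_real (g t) / (1 - \<xi> * of_real (exp (- t)))) \<in> borel_measurable ?M"
    using int int_g by (auto dest!: borel_measurable_integrable)
  have "has_bochner_integral ?M (\<lambda>t. \<Sum>r. f r t) (\<integral>t. (\<Sum>r. f r t) \<partial>?M)"
    using int by (rule has_bochner_integral_integrable)
  then have 1: "has_bochner_integral ?M (\<lambda>t. of_real (g t) / (1 - \<xi> * of_real (exp (- t)))) (\<integral>t. (\<Sum>r. f r t) \<partial>?M)"
    using has_bochner_integral_cong_AE[OF meas lim] by simp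
  have "integral\<^sup>L ?M (f r) = of_real (Gamma \<alpha>) * (of_real (powr_moment \<alpha> (r + c) p) * \<xi> ^ r)" for r
    unfolding f_def integral_mult_left_zero integral_complex_of_real powr_moment_laplace[OF \<alpha>] by simp
  then have "(\<lambda>r. of_real (Gamma \<alpha>) * (of_real (powr_moment \<alpha> (r + c) p) * \<xi> ^ r)) sums (\<integral>t. (\<Sum>r. f r t) \<partial>?M)"
    using sums by simp
  from sums_mult[OF this, of "inverse (of_real (Gamma \<alpha>))"]
  have 2: "(\<lambda>r. of_real (powr_moment \<alpha> (r + c) p) * \<xi> ^ r) sums (inverse (of_real (Gamma \<alpha>)) * (\<integral>t. (\<Sum>r. f r t) \<partial>?M))"
    using Gpos by (simp add: field_simps)
  show ?thesis
  proof (intro exI conjI, rule 2)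
    show "has_bochner_integral ?M (\<lambda>t. of_real (exp (- t * real c) * exp_moment t p) / (1 - \<xi> * of_real (exp (- t))))
        (of_real (Gamma \<alpha>) * (inverse (of_real (Gamma \<alpha>)) * (\<integral>t. (\<Sum>r. f r t) \<partial>?M)))"
      using 1 Gpos by (simp add: g_def flip: mult.assoc)
  qed
qed

text \<open>This is the integrand representing \<open>weight_gf\<close>, following
  \<open>weight_eq_powr_moment\<close> term by term: the quotient sums the regular cells, the finite
  sum over c collects the last cells, and \<xi>^p records the position p in the stencil.\<close>

definition gf_symbol :: "nat \<Rightarrow> nat \<Rightarrow> complex \<Rightarrow> real \<Rightarrow> complex" where
  "gf_symbol k i \<xi> t = (\<Sum>p\<le>k. \<xi> ^ p *
     (of_real (exp (- t * real (i - 1)) * exp_moment t (lagrange_slope k p (i - 1))) / (1 - \<xi> * of_real (exp (- t)))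
      + (\<Sum>c<i - 1. of_real (exp (- t * real c) * exp_moment t (lagrange_slope k p c)))))"

lemma weight_gf_laplace:
  assumes \<alpha>: "0 < \<alpha>" "\<alpha> < 1" and i: "1 \<le> i" "i \<le> k" and \<xi>: "cmod \<xi> < 1"
  shows "(\<lambda>m. of_real (weight \<alpha> k i m) * \<xi> ^ m) sums weight_gf \<alpha> k i \<xi>"
    and "has_bochner_integral (laplace_measure \<alpha>) (gf_symbol k i \<xi>)
      (of_real (Gamma \<alpha> * Gamma (1 - \<alpha>)) * weight_gf \<alpha> k i \<xi>)"
proof -
  let ?M = "laplace_measure \<alpha>" and ?G = "complex_of_real (Gamma (1 - \<alpha>))"
  have Gpos: "0 < Gamma \<alpha>" "0 < Gamma (1 - \<alpha>)" using \<alpha> by (simp_all add: Gamma_real_pos)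
  have "\<exists>S. \<forall>p. (\<lambda>r. of_real (powr_moment \<alpha> (r + (i - 1)) (lagrange_slope k p (i - 1))) * \<xi> ^ r) sums S p \<and>
    has_bochner_integral ?M (\<lambda>t. of_real (exp (- t * real (i - 1)) * exp_moment t (lagrange_slope k p (i - 1)))
      / (1 - \<xi> * of_real (exp (- t)))) (of_real (Gamma \<alpha>) * S p)"
    by (intro choice allI powr_moment_gf \<alpha> \<xi>)
  then obtain S where
    S: "\<And>p. (\<lambda>r. of_real (powr_moment \<alpha> (r + (i - 1)) (lagrange_slope k p (i - 1))) * \<xi> ^ r) sums S p" and
    S_int: "\<And>p. has_bochner_integral ?M (\<lambda>t. of_real (exp (- t * real (i - 1)) * exp_moment t (lagrange_slope k p (i - 1)))
      / (1 - \<xi> * of_real (exp (- t)))) (of_real (Gamma \<alpha>) * S p)"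
    by blast
  define v where "v m = (\<Sum>c<i - 1. powr_moment \<alpha> c (lagrange_slope k m c))" for m
  define T where "T = (\<Sum>p\<le>k. \<xi> ^ p * (S p + of_real (v p)))"
  \<comment> \<open>Cutting off below m = p is a shift of the power series by p, hence the factor
    \<xi>^p.\<close>
  have main: "(\<lambda>m. (if p \<le> m then of_real (powr_moment \<alpha> (m - p + (i - 1)) (lagrange_slope k p (i - 1))) else 0) * \<xi> ^ m)
      sums (\<xi> ^ p * S p)" for p
  proof -
    have "(\<lambda>m. (if p \<le> m + p then of_real (powr_moment \<alpha> (m + p - p + (i - 1)) (lagrange_slope k p (i - 1))) else 0) * \<xi> ^ (m + p))
        sums (\<xi> ^ p * S p)"
      using sums_mult[OF S[of p], of "\<xi> ^ p"] by (simp add: power_add mult_ac)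
    then show ?thesis
      by (subst (asm) sums_zero_iff_shift) auto
  qed
  have fin: "(\<lambda>m. (if m \<le> k then of_real (v m) else 0) * \<xi> ^ m) sums (\<Sum>m\<le>k. (if m \<le> k then of_real (v m) else 0) * \<xi> ^ m)"
    by (rule sums_finite) auto
  have w: "of_real (Gamma (1 - \<alpha>) * weight \<alpha> k i m) * \<xi> ^ m =
      (\<Sum>p\<le>k. (if p \<le> m then of_real (powr_moment \<alpha> (m - p + (i - 1)) (lagrange_slope k p (i - 1))) else 0) * \<xi> ^ m)
      + (if m \<le> k then of_real (v m) else 0) * \<xi> ^ m" for m
    unfolding weight_eq_powr_moment[OF \<alpha> i] v_def[symmetric]
    by (simp add: distrib_right sum_distrib_right if_distrib[of of_real] cong: if_cong)
  have "(\<lambda>m. of_real (Gamma (1 - \<alpha>) * weight \<alpha> k i m) * \<xi> ^ m) sums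
      ((\<Sum>p\<le>k. \<xi> ^ p * S p) + (\<Sum>m\<le>k. (if m \<le> k then of_real (v m) else 0) * \<xi> ^ m))"
    unfolding w by (intro sums_add sums_sum main fin)
  also have "(\<Sum>m\<le>k. (if m \<le> k then of_real (v m) else 0) * \<xi> ^ m) = (\<Sum>p\<le>k. \<xi> ^ p * of_real (v p))"
    by (intro sum.cong) auto
  also have "(\<Sum>p\<le>k. \<xi> ^ p * S p) + (\<Sum>p\<le>k. \<xi> ^ p * of_real (v p)) = T"
    by (simp add: T_def distrib_left sum.distrib)
  finally have "(\<lambda>m. of_real (Gamma (1 - \<alpha>) * weight \<alpha> k i m) * \<xi> ^ m) sums T" .
  from sums_mult[OF this, of "inverse ?G"]
  have sums: "(\<lambda>m. of_real (weight \<alpha> k i m) * \<xi> ^ m) sums (inverse ?G * T)"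
    using Gpos by (simp add: field_simps)
  then have gf: "weight_gf \<alpha> k i \<xi> = inverse ?G * T"
    by (simp add: weight_gf_def sums_iff)
  show "(\<lambda>m. of_real (weight \<alpha> k i m) * \<xi> ^ m) sums weight_gf \<alpha> k i \<xi>"
    using sums gf by simp
  have v_int: "has_bochner_integral ?M (\<lambda>t. \<Sum>c<i - 1. complex_of_real (exp (- t * real c) * exp_moment t (lagrange_slope k p c)))
      (of_real (Gamma \<alpha>) * of_real (v p))" for p
  proof -
    have "has_bochner_integral ?M (\<lambda>t. \<Sum>c<i - 1. complex_of_real (exp (- t * real c) * exp_moment t (lagrange_slope k p c)))
      (\<Sum>c<i - 1. complex_of_real (Gamma \<alpha> * powr_moment \<alpha> c (lagrange_slope k p c)))"
      by (intro has_bochner_integral_sum has_bochner_integral_of_real)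
        (use powr_moment_laplace[OF \<alpha>] integrable_exp_times_exp_moment[OF \<alpha>] in \<open>simp add: has_bochner_integral_iff\<close>)
    then show ?thesis by (simp add: v_def sum_distrib_left)
  qed
  have "has_bochner_integral ?M (gf_symbol k i \<xi>)
      (\<Sum>p\<le>k. \<xi> ^ p * (of_real (Gamma \<alpha>) * S p + of_real (Gamma \<alpha>) * of_real (v p)))"
    unfolding gf_symbol_def
    by (intro has_bochner_integral_sum has_bochner_integral_mult_right has_bochner_integral_add S_int v_int)
  also have "(\<Sum>p\<le>k. \<xi> ^ p * (of_real (Gamma \<alpha>) * S p + of_real (Gamma \<alpha>) * of_real (v p))) = of_real (Gamma \<alpha>) * T"
    unfolding T_def sum_distrib_left by (simp add: algebra_simps)
  also have "\<dots> = of_real (Gamma \<alpha> * Gamma (1 - \<alpha>)) * weight_gf \<alpha> k i \<xi>"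
    using Gpos by (simp add: gf)
  finally show "has_bochner_integral ?M (gf_symbol k i \<xi>)
      (of_real (Gamma \<alpha> * Gamma (1 - \<alpha>)) * weight_gf \<alpha> k i \<xi>)" .
qed

section \<open>Explicit slopes for k <= 3 and reduction of the symbol to a cubic\<close>

lemma nat_intervals: "{0..1::nat} = {0, 1}" "{0..2::nat} = {0, 1, 2}" "{0..3::nat} = {0, 1, 2, 3}"
  by auto

lemma lagrange_slope_1:
  "lagrange_slope 1 0 c = [:1:]" "lagrange_slope 1 1 c = [:-1:]"
  by (simp_all add: lagrange_slope_def lagrange_def nat_intervals(1) insert_Diff_if pderiv_pCons pcompose_pCons
      del: One_nat_def)

lemma lagrange_slope_2:
  "lagrange_slope 2 0 c = [:3/2 - real c, -1:]"
  "lagrange_slope 2 1 c = [:2 * real c - 2, 2:]"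
  "lagrange_slope 2 2 c = [:1/2 - real c, -1:]"
  by (simp_all add: lagrange_slope_def lagrange_def nat_intervals(2) insert_Diff_if pderiv_pCons pcompose_pCons field_simps)

lemma lagrange_slope_3:
  "lagrange_slope 3 0 c = [:(3 * real c ^ 2 - 12 * real c + 11) / 6, real c - 2, 1/2:]"
  "lagrange_slope 3 1 c = [:- (3 * real c ^ 2 - 10 * real c + 6) / 2, 5 - 3 * real c, -3/2:]"
  "lagrange_slope 3 2 c = [:(3 * real c ^ 2 - 8 * real c + 3) / 2, 3 * real c - 4, 3/2:]"
  "lagrange_slope 3 3 c = [:- (3 * real c ^ 2 - 6 * real c + 2) / 6, 1 - real c, -1/2:]"
  by (simp_all add: lagrange_slope_def lagrange_def nat_intervals(3) insert_Diff_if pderiv_pCons pcompose_pCons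
      power2_eq_square field_simps)

text \<open>Interpolation reproduces constants, so the basis polynomials sum to 1 and their
  derivatives cancel; for k <= 3 this is read off the explicit formulas. It is the source of the
  zero of the generating function at 1.\<close>

lemma sum_lagrange_slope:
  assumes "1 \<le> k" "k \<le> 3"
  shows "(\<Sum>p\<le>k. lagrange_slope k p c) = 0"
proof -
  consider "k = 1" | "k = 2" | "k = 3" using assms by linarith
  then show ?thesis
  proof cases
    case 1
    then show ?thesis using lagrange_slope_1[of c] by simp
  next
    case 2
    then show ?thesis using lagrange_slope_2[of c] by (simp add: numeral_2_eq_2)
  next
    case 3
    then show ?thesis using lagrange_slope_3[of c] by (simp add: numeral_3_eq_3 numeral_2_eq_2 field_simps)
  qed
qed

lemma gf_symbol_times_denominator:
  assumes "1 - \<xi> * of_real (exp (- t)) \<noteq> 0"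
  shows "gf_symbol k i \<xi> t * (1 - \<xi> * of_real (exp (- t))) = (\<Sum>p\<le>k. \<xi> ^ p *
     (of_real (exp (- t) ^ (i - 1) * exp_moment t (lagrange_slope k p (i - 1)))
      + (\<Sum>c<i - 1. of_real (exp (- t) ^ c * exp_moment t (lagrange_slope k p c))) * (1 - \<xi> * of_real (exp (- t)))))"
proof -
  have e: "exp (- t * real c) = exp (- t) ^ c" for c
    by (simp add: mult.commute flip: exp_of_nat_mult)
  have d: "x * (a / (1 - \<xi> * of_real (exp (- t))) + b) * (1 - \<xi> * of_real (exp (- t)))
      = x * (a + b * (1 - \<xi> * of_real (exp (- t))))" for x a b
    using assms by (simp add: distrib_right[of _ b])
  show ?thesis
    unfolding gf_symbol_def e by (subst sum_distrib_right) (intro sum.cong refl d)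
qed

text \<open>The polynomials 1, 1/2 - x, 1/6 - x^2/2 span all quadratics. The last two have mean zero
  on [0, 1], so the coefficient of \<open>A\<close> is the mean of the given polynomial.\<close>

lemma exp_moment_basis:
  fixes t :: real
  defines "A \<equiv> exp_moment t 1" and "B \<equiv> exp_moment t [:1/2, -1:]" and "D \<equiv> exp_moment t [:1/6, 0, -1/2:]"
  shows "exp_moment t [:a:] = a * A" "exp_moment t [:a, b:] = (a + b / 2) * A - b * B"
    "exp_moment t [:a, b, c:] = (a + b / 2 + c / 3) * A - b * B - 2 * c * D"
  unfolding A_def B_def D_def
    exp_moment_const[of t a] exp_moment_linear[of t a b] exp_moment_quadratic[of t a b c] exp_moment_linear[of t "1/2" "-1"]
    exp_moment_quadratic[of t "1/6" 0 "-1/2"]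
  by (simp_all add: field_simps)

lemma exp_moment_lagrange_slope:
  fixes t :: real
  defines "A \<equiv> exp_moment t 1" and "B \<equiv> exp_moment t [:1/2, -1:]" and "D \<equiv> exp_moment t [:1/6, 0, -1/2:]"
  shows "exp_moment t (lagrange_slope 1 0 0) = A" "exp_moment t (lagrange_slope 1 1 0) = - A"
    "exp_moment t (lagrange_slope 2 0 0) = A + B" "exp_moment t (lagrange_slope 2 1 0) = - A - 2 * B"
    "exp_moment t (lagrange_slope 2 2 0) = B"
    "exp_moment t (lagrange_slope 2 0 1) = B" "exp_moment t (lagrange_slope 2 1 1) = A - 2 * B"
    "exp_moment t (lagrange_slope 2 2 1) = B - A"
    "exp_moment t (lagrange_slope 3 0 0) = A + 2 * B - D" "exp_moment t (lagrange_slope 3 1 0) = 3 * D - 5 * B - A"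
    "exp_moment t (lagrange_slope 3 2 0) = 4 * B - 3 * D" "exp_moment t (lagrange_slope 3 3 0) = D - B"
    "exp_moment t (lagrange_slope 3 0 1) = B - D" "exp_moment t (lagrange_slope 3 1 1) = A - 2 * B + 3 * D"
    "exp_moment t (lagrange_slope 3 2 1) = B - A - 3 * D" "exp_moment t (lagrange_slope 3 3 1) = D"
    "exp_moment t (lagrange_slope 3 0 2) = - D" "exp_moment t (lagrange_slope 3 1 2) = B + 3 * D"
    "exp_moment t (lagrange_slope 3 2 2) = A - 2 * B - 3 * D" "exp_moment t (lagrange_slope 3 3 2) = B + D - A"
    "exp_moment t [:1/3, -1, 1/2:] = B - D"
  unfolding lagrange_slope_1 lagrange_slope_2 lagrange_slope_3 exp_moment_basis[of t, folded A_def B_def D_def]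
  by (simp_all add: field_simps)

text \<open>Since the slopes sum to zero, the numerator vanishes at \<xi> = 1 and is expanded in
  powers of 1 - \<xi>, pair by pair. For fixed k only the coefficient of (1 - \<xi>)^k inside the
  bracket depends on i.\<close>

lemma gf_symbol_cubic:
  fixes \<xi> :: complex and t A q :: real
  assumes t: "0 < t" and k: "1 \<le> i" "i \<le> k" "k \<le> 3" and nz: "1 - \<xi> * of_real (exp (- t)) \<noteq> 0"
  defines "A \<equiv> exp_moment t 1" and "q \<equiv> exp (- t)"
  obtains B C E :: real where "0 \<le> B" "0 \<le> C" "0 \<le> E" "E \<le> q * C" "3 * C \<le> A \<or> E = 0 \<and> C \<le> q * B"
    "gf_symbol k i \<xi> t * (1 - \<xi> * q) = (1 - \<xi>) * (A + B * (1 - \<xi>) + C * (1 - \<xi>)^2 + E * (1 - \<xi>)^3)"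
proof -
  define B where "B = exp_moment t [:1/2, -1:]"
  define C where "C = exp_moment t [:1/3, -1, 1/2:]"
  define D where "D = exp_moment t [:1/6, 0, -1/2:]"
  have q: "0 < q" "q < 1" using t by (auto simp: q_def)
  have A: "0 < A" and B: "0 \<le> B" and C: "0 \<le> C" and D: "0 \<le> D" and CA: "3 * C \<le> A" and CD: "q * D \<le> C"
    unfolding A_def B_def C_def D_def q_def
    using t exp_moment_1_pos[of t] exp_moment_half_minus_nonneg[of t] exp_moment_third_minus_nonneg[of t] exp_moment_sixth_minus_nonneg[of t]
      three_times_moment_third_minus_le[of t] exp_times_moment_sixth_minus_le[of t]
    by auto
  have CBD: "C = B - D"
    unfolding B_def C_def D_def by (rule exp_moment_lagrange_slope)
  note denom = gf_symbol_times_denominator[OF nz, of k i, folded q_def]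
  note moments = exp_moment_lagrange_slope[of t, folded A_def B_def D_def, unfolded One_nat_def numeral_2_eq_2 numeral_3_eq_3]
  consider "k = 1" "i = 1" | "k = 2" "i = 1" | "k = 2" "i = 2" | "k = 3" "i = 1" | "k = 3" "i = 2" | "k = 3" "i = 3"
    using k by linarith
  then show ?thesis
  proof cases
    case 1
    have "gf_symbol k i \<xi> t * (1 - \<xi> * q) = (1 - \<xi>) * A"
      unfolding denom unfolding 1 by (simp add: moments algebra_simps)
    then show ?thesis
      using q A by (intro that[of 0 0 0]) auto
  next
    case 2
    have "gf_symbol k i \<xi> t * (1 - \<xi> * q) = (1 - \<xi>) * (A + B * (1 - \<xi>))"
      unfolding denom unfolding 2 by (simp add: moments numeral_2_eq_2 algebra_simps)
    then show ?thesis
      using q A B by (intro that[of B 0 0]) auto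
  next
    case 3
    \<comment> \<open>The quadratic coefficient is now \<open>q * B\<close>, so the second
      alternative, E = 0 and C <= q B, is the one that holds by construction.\<close>
    have "gf_symbol k i \<xi> t * (1 - \<xi> * q) = (1 - \<xi>) * (A + B * (1 - \<xi>) + (q * B) * (1 - \<xi>)^2)"
      unfolding denom unfolding 3 by (simp add: moments numeral_2_eq_2 algebra_simps)
    then show ?thesis
      using q A B by (intro that[of B "q * B" 0]) auto
  next
    case 4
    have "gf_symbol k i \<xi> t * (1 - \<xi> * q) = (1 - \<xi>) * (A + B * (1 - \<xi>) + C * (1 - \<xi>)^2)"
      unfolding denom unfolding 4 CBD by (simp add: moments numeral_3_eq_3 numeral_2_eq_2 algebra_simps)
    then show ?thesis
      using q A B C CA by (intro that[of B C 0]) auto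
  next
    case 5
    have "gf_symbol k i \<xi> t * (1 - \<xi> * q) = (1 - \<xi>) * (A + B * (1 - \<xi>) + C * (1 - \<xi>)^2 + (q * C) * (1 - \<xi>)^3)"
      unfolding denom unfolding 5 CBD by (simp add: moments numeral_3_eq_3 numeral_2_eq_2 algebra_simps)
    then show ?thesis
      using q A B C CA by (intro that[of B C "q * C"]) auto
  next
    case 6
    \<comment> \<open>The cubic coefficient q(C - qD) is nonnegative by \<open>CD\<close>, and at
      most qC because D >= 0.\<close>
    have "gf_symbol k i \<xi> t * (1 - \<xi> * q)
        = (1 - \<xi>) * (A + B * (1 - \<xi>) + C * (1 - \<xi>)^2 + (q * (C - q * D)) * (1 - \<xi>)^3)"
      unfolding denom unfolding 6 CBD by (simp add: moments numeral_3_eq_3 numeral_2_eq_2 algebra_simps)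
    then show ?thesis
      using q A B C D CA CD by (intro that[of B C "q * (C - q * D)"]) auto
  qed
qed

section \<open>Positivity and boundary behaviour\<close>

text \<open>The pointwise bound by one twelfth of \<open>exp_moment t 1\<close> is integrated over
  t. Its average is a multiple of \<open>powr_moment \<alpha> 0 1\<close>, so the lower bound does
  not depend on \<xi>.\<close>

lemma Re_weight_gf_ge:
  assumes \<alpha>: "0 < \<alpha>" "\<alpha> < 1" and k: "1 \<le> i" "i \<le> k" "k \<le> 3" and \<xi>: "cmod \<xi> < 1"
  shows "powr_moment \<alpha> 0 1 / (12 * Gamma (1 - \<alpha>)) \<le> Re (weight_gf \<alpha> k i \<xi> / (1 - \<xi>))"
proof -
  let ?M = "laplace_measure \<alpha>"
  define W where "W = weight_gf \<alpha> k i \<xi> / (1 - \<xi>)"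
  have Gpos: "0 < Gamma \<alpha>" "0 < Gamma (1 - \<alpha>)" using \<alpha> by (simp_all add: Gamma_real_pos)
  have \<xi>1: "1 - \<xi> \<noteq> 0" using \<xi> by auto
  have pointwise: "exp_moment t 1 / 12 \<le> Re (gf_symbol k i \<xi> t / (1 - \<xi>))" if t: "0 < t" for t
  proof -
    define q where "q = exp (- t)"
    have q: "0 \<le> q" "q < 1" using t by (auto simp: q_def)
    have nz: "1 - \<xi> * of_real q \<noteq> 0"
    proof
      assume "1 - \<xi> * of_real q = 0"
      then have "cmod (\<xi> * of_real q) = 1" by simp
      moreover have "cmod (\<xi> * of_real q) \<le> cmod \<xi>"
        using q by (simp add: norm_mult mult_left_le)
      ultimately show False using \<xi> by simp
    qed
    obtain B C E where BCE: "0 \<le> B" "0 \<le> C" "0 \<le> E" "E \<le> q * C" "3 * C \<le> exp_moment t 1 \<or> E = 0 \<and> C \<le> q * B"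
      and eq: "gf_symbol k i \<xi> t * (1 - \<xi> * q)
        = (1 - \<xi>) * (exp_moment t 1 + B * (1 - \<xi>) + C * (1 - \<xi>)^2 + E * (1 - \<xi>)^3)"
      using gf_symbol_cubic[OF t k nz[unfolded q_def]] unfolding q_def by blast
    have "exp_moment t 1 / 12 \<le> Re ((exp_moment t 1 + B * (1 - \<xi>) + C * (1 - \<xi>)^2 + E * (1 - \<xi>)^3) / (1 - q * \<xi>))"
      using \<xi> exp_moment_1_pos[of t] by (intro Re_cubic_div_disc q BCE) auto
    also have "(exp_moment t 1 + B * (1 - \<xi>) + C * (1 - \<xi>)^2 + E * (1 - \<xi>)^3) / (1 - q * \<xi>) = gf_symbol k i \<xi> t / (1 - \<xi>)"
      using eq nz \<xi>1 by (simp add: frac_eq_eq mult.commute)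
    finally show ?thesis .
  qed
  have "has_bochner_integral ?M (\<lambda>t. gf_symbol k i \<xi> t / (1 - \<xi>)) (of_real (Gamma \<alpha> * Gamma (1 - \<alpha>)) * weight_gf \<alpha> k i \<xi> / (1 - \<xi>))"
    by (intro has_bochner_integral_divide weight_gf_laplace(2) \<alpha> k \<xi> order.trans[OF k(2)]) auto
  then have "has_bochner_integral ?M (\<lambda>t. Re (gf_symbol k i \<xi> t / (1 - \<xi>))) (Re (of_real (Gamma \<alpha> * Gamma (1 - \<alpha>)) * W))"
    unfolding W_def times_divide_eq_right by (rule has_bochner_integral_bounded_linear[OF bounded_linear_Re])
  then have 1: "integrable ?M (\<lambda>t. Re (gf_symbol k i \<xi> t / (1 - \<xi>)))"
    and 2: "(\<integral>t. Re (gf_symbol k i \<xi> t / (1 - \<xi>)) \<partial>?M) = Gamma \<alpha> * Gamma (1 - \<alpha>) * Re W"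
    by (simp_all add: has_bochner_integral_iff Re_divide)
  have "Gamma \<alpha> * powr_moment \<alpha> 0 1 / 12 = (\<integral>t. exp_moment t 1 / 12 \<partial>?M)"
    using powr_moment_laplace[OF \<alpha>, of 0 1] by simp
  also have "\<dots> \<le> (\<integral>t. Re (gf_symbol k i \<xi> t / (1 - \<xi>)) \<partial>?M)"
  proof (rule integral_mono_AE[OF _ 1])
    show "integrable ?M (\<lambda>t. exp_moment t 1 / 12)"
      using integrable_exp_times_exp_moment[OF \<alpha>, of 0 1] by simp
    show "AE t in ?M. exp_moment t 1 / 12 \<le> Re (gf_symbol k i \<xi> t / (1 - \<xi>))"
      using AE_laplace_measure_pos by eventually_elim (rule pointwise)
  qed
  finally have "Gamma \<alpha> * (powr_moment \<alpha> 0 1 / 12) \<le> Gamma \<alpha> * (Gamma (1 - \<alpha>) * Re W)"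
    unfolding 2 by (simp add: mult.assoc)
  then show ?thesis
    using Gpos by (simp add: W_def field_simps)
qed

section \<open>Absolute summability of the weights and Abel summation\<close>

lemma summable_shift_diff:
  fixes x :: "nat \<Rightarrow> real"
  assumes "summable (\<lambda>r. \<bar>x (Suc r) - x r\<bar>)"
  shows "summable (\<lambda>r. \<bar>x (r + e) - x r\<bar>)"
proof (induction e)
  case (Suc e)
  have "summable (\<lambda>r. \<bar>x (Suc (r + e)) - x (r + e)\<bar>)"
    using summable_ignore_initial_segment[OF assms, of e] by simp
  from summable_add[OF this Suc] show ?case
    by (rule summable_comparison_test'[where N = 0]) simp
qed simp

lemma sum_shift_diff_tendsto_0:
  fixes x :: "nat \<Rightarrow> real"
  assumes "x \<longlonglongrightarrow> 0"
  shows "(\<lambda>n. (\<Sum>r<n + e. x r) - (\<Sum>r<n. x r)) \<longlonglongrightarrow> 0"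
proof (induction e)
  case (Suc e)
  have "(\<lambda>n. x (n + e)) \<longlonglongrightarrow> 0"
    using assms by (rule LIMSEQ_ignore_initial_segment)
  from tendsto_add[OF Suc this] show ?case by (simp add: algebra_simps)
qed simp

text \<open>The moments \<open>x p r\<close> need not be absolutely summable, but for fixed r they
  cancel over p. A late weight is thus a sum of differences of nearby moments, controlled by bounded
  variation. In the partial sums the same cancellation leaves, for each p, boundedly many late
  terms, which tend to 0.\<close>

lemma
  assumes \<alpha>: "0 < \<alpha>" "\<alpha> < 1" and k: "1 \<le> i" "i \<le> k" "k \<le> 3"
  shows summable_abs_weight: "summable (\<lambda>m. \<bar>weight \<alpha> k i m\<bar>)"
    and sum_weight_tendsto_0: "(\<lambda>n. \<Sum>m<n. weight \<alpha> k i m) \<longlonglongrightarrow> 0"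
proof -
  define x where "x p r = powr_moment \<alpha> (r + (i - 1)) (lagrange_slope k p (i - 1))" for p r
  define v where "v m = (\<Sum>c<i - 1. powr_moment \<alpha> c (lagrange_slope k m c))" for m
  have Gpos: "0 < Gamma (1 - \<alpha>)" using \<alpha> by (simp add: Gamma_real_pos)
  have k1: "1 \<le> k" using k by simp
  have w: "Gamma (1 - \<alpha>) * weight \<alpha> k i m = (\<Sum>p\<le>k. if p \<le> m then x p (m - p) else 0) + (if m \<le> k then v m else 0)" for m
    unfolding x_def v_def by (rule weight_eq_powr_moment[OF \<alpha> k(1,2)])
  have slope0: "(\<Sum>p\<le>k. powr_moment \<alpha> r (lagrange_slope k p c)) = 0" for r c
    using sum_lagrange_slope[OF k1 k(3), of c] powr_moment_sum[OF \<alpha>, of r "\<lambda>p. lagrange_slope k p c" "{..k}"]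
    by (simp add: powr_moment_def)
  have x0: "(\<Sum>p\<le>k. x p r) = 0" for r
    unfolding x_def by (rule slope0)
  have v0: "(\<Sum>m\<le>k. v m) = 0"
    unfolding v_def by (subst sum.swap) (simp add: slope0)
  have x_lim: "x p \<longlonglongrightarrow> 0" for p
    unfolding x_def using LIMSEQ_ignore_initial_segment[OF powr_moment_tendsto_0[OF \<alpha>]] .
  have x_bv: "summable (\<lambda>r. \<bar>x p (Suc r) - x p r\<bar>)" for p
    unfolding x_def
    using summable_ignore_initial_segment[OF powr_moment_bounded_variation[OF \<alpha>, of "lagrange_slope k p (i - 1)"], of "i - 1"]
    by simp
  \<comment> \<open>Beyond index k the corrections \<open>v\<close> are absent and the condition
    \<open>p <= m\<close> holds for every p.\<close>
  have far: "\<bar>Gamma (1 - \<alpha>) * weight \<alpha> k i (m + Suc k)\<bar> \<le> (\<Sum>p\<le>k. \<bar>x p (m + (Suc k - p)) - x p m\<bar>)" for m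
  proof -
    have "Gamma (1 - \<alpha>) * weight \<alpha> k i (m + Suc k) = (\<Sum>p\<le>k. x p (m + (Suc k - p)))"
      unfolding w by (auto intro!: sum.cong)
    also have "\<dots> = (\<Sum>p\<le>k. x p (m + (Suc k - p)) - x p m)"
      by (simp add: sum_subtractf x0)
    finally show ?thesis by (simp only: sum_abs)
  qed
  have "summable (\<lambda>m. \<Sum>p\<le>k. \<bar>x p (m + (Suc k - p)) - x p m\<bar>)"
    by (intro summable_sum summable_shift_diff x_bv)
  then have "summable (\<lambda>m. Gamma (1 - \<alpha>) * \<bar>weight \<alpha> k i (m + Suc k)\<bar>)"
  proof (rule summable_comparison_test'[where N = 0])
    show "norm (Gamma (1 - \<alpha>) * \<bar>weight \<alpha> k i (m + Suc k)\<bar>) \<le> (\<Sum>p\<le>k. \<bar>x p (m + (Suc k - p)) - x p m\<bar>)" for m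
      using far[of m] by (simp add: abs_mult)
  qed
  then have "summable (\<lambda>m. \<bar>weight \<alpha> k i (m + Suc k)\<bar>)"
    using Gpos by (subst (asm) summable_cmult_iff) auto
  then show "summable (\<lambda>m. \<bar>weight \<alpha> k i m\<bar>)"
    by (subst (asm) summable_iff_shift)
  have shift: "(\<Sum>m<n. if p \<le> m then x p (m - p) else 0) = (\<Sum>r<n - p. x p r)" for n p
    by (induction n) (auto simp: Suc_diff_le not_le)
  have partial: "Gamma (1 - \<alpha>) * (\<Sum>m<n + Suc k. weight \<alpha> k i m)
      = (\<Sum>p\<le>k. (\<Sum>r<n + (Suc k - p). x p r) - (\<Sum>r<n. x p r))" for n
  proof -
    have "Gamma (1 - \<alpha>) * (\<Sum>m<n + Suc k. weight \<alpha> k i m)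
        = (\<Sum>p\<le>k. \<Sum>m<n + Suc k. if p \<le> m then x p (m - p) else 0) + (\<Sum>m<n + Suc k. if m \<le> k then v m else 0)"
      unfolding sum_distrib_left w sum.distrib by (subst sum.swap) (rule refl)
    also have "(\<Sum>m<n + Suc k. if m \<le> k then v m else 0) = (\<Sum>m\<le>k. v m)"
      by (rule sum.mono_neutral_cong_right) auto
    also have "(\<Sum>p\<le>k. \<Sum>m<n + Suc k. if p \<le> m then x p (m - p) else 0) = (\<Sum>p\<le>k. \<Sum>r<n + (Suc k - p). x p r)"
      unfolding shift by (auto intro!: sum.cong)
    also have "\<dots> + (\<Sum>m\<le>k. v m) = (\<Sum>p\<le>k. (\<Sum>r<n + (Suc k - p). x p r)) - (\<Sum>r<n. \<Sum>p\<le>k. x p r)"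
      by (simp add: x0 v0)
    also have "\<dots> = (\<Sum>p\<le>k. (\<Sum>r<n + (Suc k - p). x p r) - (\<Sum>r<n. x p r))"
      unfolding sum_subtractf by (subst (2) sum.swap) (rule refl)
    finally show ?thesis .
  qed
  have "(\<lambda>n. \<Sum>p\<le>k. (\<Sum>r<n + (Suc k - p). x p r) - (\<Sum>r<n. x p r)) \<longlonglongrightarrow> (\<Sum>p\<le>k. 0)"
    by (intro tendsto_sum sum_shift_diff_tendsto_0 x_lim)
  then have "(\<lambda>n. Gamma (1 - \<alpha>) * (\<Sum>m<n + Suc k. weight \<alpha> k i m)) \<longlonglongrightarrow> 0"
    unfolding partial by simp
  from tendsto_mult_left[OF this, of "inverse (Gamma (1 - \<alpha>))"]
  have "(\<lambda>n. \<Sum>m<n + Suc k. weight \<alpha> k i m) \<longlonglongrightarrow> 0"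
    using Gpos by (simp flip: mult.assoc)
  then show "(\<lambda>n. \<Sum>m<n. weight \<alpha> k i m) \<longlonglongrightarrow> 0"
    by (rule LIMSEQ_offset)
qed

text \<open>Cauchy product with the geometric series: dividing by 1 - x accumulates the
  coefficients. This serves Abel's theorem and also identifies the series of the phi_n with the
  quotient by 1 - x.\<close>

lemma partial_sums_gf:
  fixes a :: "nat \<Rightarrow> real"
  assumes "\<bar>x\<bar> < 1" and a: "summable (\<lambda>n. \<bar>a n * x ^ n\<bar>)"
  shows "(\<lambda>n. (\<Sum>m\<le>n. a m) * x ^ n) sums ((\<Sum>n. a n * x ^ n) / (1 - x))"
proof -
  have "(\<lambda>n. \<Sum>m\<le>n. (a m * x ^ m) * x ^ (n - m)) sums ((\<Sum>n. a n * x ^ n) * (\<Sum>n. x ^ n))"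
    using assms by (intro Cauchy_product_sums) (auto simp: power_abs summable_geometric)
  also have "(\<lambda>n. \<Sum>m\<le>n. (a m * x ^ m) * x ^ (n - m)) = (\<lambda>n. (\<Sum>m\<le>n. a m) * x ^ n)"
    by (auto simp: sum_distrib_right mult.assoc fun_eq_iff simp flip: power_add intro!: sum.cong)
  finally show ?thesis
    using assms(1) by (simp add: suminf_geometric)
qed

text \<open>Abel's theorem in the one-sided form that contradicts a positive lower bound. The power
  series is 1 - x times the series of s_n x^n; the terms with n >= N contribute at most half of
  \<epsilon>, the earlier ones at most (1 - x) K.\<close>

lemma abel_sums_0:
  fixes f :: "nat \<Rightarrow> real"
  assumes f: "f sums 0" and "0 < \<epsilon>"
  shows "\<exists>x. 0 < x \<and> x < 1 \<and> (\<Sum>n. f n * x ^ n) < \<epsilon>"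
proof -
  define s where "s n = (\<Sum>m\<le>n. f m)" for n
  have s: "s \<longlonglongrightarrow> 0"
    using f unfolding s_def by (simp add: sums_def_le)
  obtain N where N: "\<And>n. N \<le> n \<Longrightarrow> \<bar>s n\<bar> < \<epsilon> / 2"
    using LIMSEQ_D[OF s, of "\<epsilon> / 2"] \<open>0 < \<epsilon>\<close> by auto
  define K where "K = (\<Sum>n<N. \<bar>s n\<bar>)"
  have K: "0 \<le> K" by (simp add: K_def sum_nonneg)
  \<comment> \<open>The entry 1/2 keeps x positive, the other makes (1 - x) K less than half of
    \<epsilon>; K + 1 avoids dividing by zero.\<close>
  define x where "x = 1 - min (1/2) (\<epsilon> / (4 * (K + 1)))"
  have x: "0 < x" "x < 1" and xK: "(1 - x) * K < \<epsilon> / 2"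
  proof -
    have "0 < min (1/2) (\<epsilon> / (4 * (K + 1)))" using K \<open>0 < \<epsilon>\<close> by simp
    then show "0 < x" "x < 1" unfolding x_def by linarith+
    have "(1 - x) * K \<le> \<epsilon> / (4 * (K + 1)) * K"
      using K by (intro mult_right_mono) (auto simp: x_def)
    also have "\<dots> < \<epsilon> / 2" using K \<open>0 < \<epsilon>\<close> by (simp add: field_simps add_pos_nonneg)
    finally show "(1 - x) * K < \<epsilon> / 2" .
  qed
  have "Bseq f" using f summable_LIMSEQ_zero convergent_imp_Bseq convergentI sums_summable by blast
  then obtain L where L: "\<And>n. \<bar>f n\<bar> \<le> L" by (auto simp: Bseq_def)
  have geo: "summable (\<lambda>n. x ^ n)" using x by (intro summable_geometric) simp
  have abs_f: "summable (\<lambda>n. \<bar>f n * x ^ n\<bar>)"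
    using summable_mult[OF geo, of L]
    by (rule summable_comparison_test'[where N = 0]) (use x L in \<open>auto simp: abs_mult power_abs intro: mult_right_mono\<close>)
  have sums: "(\<lambda>n. s n * x ^ n) sums ((\<Sum>n. f n * x ^ n) / (1 - x))"
    unfolding s_def using x by (intro partial_sums_gf abs_f) simp
  have start: "(\<lambda>n. if n < N then \<bar>s n\<bar> else 0) sums K"
    unfolding K_def using sums_If_finite_set[of "{..<N}" "\<lambda>n. \<bar>s n\<bar>"] by simp
  have tail: "(\<lambda>n. (if n < N then \<bar>s n\<bar> else 0) + \<epsilon> / 2 * x ^ n) sums (K + \<epsilon> / 2 * (1 / (1 - x)))"
    using x by (intro sums_add start sums_mult geometric_sums) simp
  have "(\<Sum>n. f n * x ^ n) / (1 - x) \<le> K + \<epsilon> / 2 * (1 / (1 - x))"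
  proof (rule sums_le[OF _ sums tail])
    show "s n * x ^ n \<le> (if n < N then \<bar>s n\<bar> else 0) + \<epsilon> / 2 * x ^ n" for n
    proof (cases "n < N")
      case True
      have "s n * x ^ n \<le> \<bar>s n\<bar> * 1"
        using x by (intro mult_mono) (auto simp: power_le_one)
      then show ?thesis using True x \<open>0 < \<epsilon>\<close> by (simp add: add_increasing2)
    next
      case False
      have "s n * x ^ n \<le> \<epsilon> / 2 * x ^ n"
        using x N[of n] False by (intro mult_right_mono) auto
      then show ?thesis using False by simp
    qed
  qed
  from mult_left_mono[OF this, of "1 - x"] have "(\<Sum>n. f n * x ^ n) \<le> (1 - x) * (K + \<epsilon> / 2 * (1 / (1 - x)))"
    using x by simp
  also have "\<dots> = (1 - x) * K + \<epsilon> / 2"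
    using x by (simp add: field_simps)
  finally have "(\<Sum>n. f n * x ^ n) \<le> (1 - x) * K + \<epsilon> / 2" .
  then show ?thesis using x xK by (intro exI[of _ x]) auto
qed

lemma continuous_on_weight_gf:
  assumes "summable (\<lambda>m. \<bar>weight \<alpha> k i m\<bar>)"
  shows "continuous_on (cball 0 1) (weight_gf \<alpha> k i)"
proof -
  have "uniform_limit (cball 0 1) (\<lambda>n \<xi>. \<Sum>m<n. complex_of_real (weight \<alpha> k i m) * \<xi> ^ m) (weight_gf \<alpha> k i) sequentially"
    unfolding weight_gf_def
  proof (rule Weierstrass_m_test[OF _ assms])
    show "norm (complex_of_real (weight \<alpha> k i m) * \<xi> ^ m) \<le> \<bar>weight \<alpha> k i m\<bar>" if "\<xi> \<in> cball 0 1" for m and \<xi> :: complex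
      using that by (simp add: norm_mult norm_power mult_left_le power_le_one)
  qed
  then show ?thesis
    by (rule uniform_limit_theorem[rotated]) (auto intro!: always_eventually continuous_intros)
qed

theorem theorem3p12:
  fixes \<alpha> :: real and k i :: nat
  assumes "0 < \<alpha>" "\<alpha> < 1" "1 \<le> i" "i \<le> k" "k \<le> 3"
  shows "summable (\<lambda>m. \<bar>weight \<alpha> k i m\<bar>)
    \<and> (\<forall>\<xi>::complex. cmod \<xi> \<le> 1 \<and> \<xi> \<noteq> 1 \<longrightarrow> weight_gf \<alpha> k i \<xi> \<noteq> 0)
    \<and> weight_gf \<alpha> k i 1 = 0
    \<and> \<not> ((\<lambda>n. \<Sum>m\<le>n. weight \<alpha> k i m) sums 0)"
proof (intro conjI allI impI)
  define \<delta> where "\<delta> = powr_moment \<alpha> 0 1 / (12 * Gamma (1 - \<alpha>))"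
  have \<delta>: "0 < \<delta>"
    unfolding \<delta>_def using assms powr_moment_0_1_pos[of \<alpha>] by (simp add: Gamma_real_pos)
  have ge: "\<delta> \<le> Re (weight_gf \<alpha> k i \<xi> / (1 - \<xi>))" if "cmod \<xi> < 1" for \<xi>
    unfolding \<delta>_def using assms that by (rule Re_weight_gf_ge)
  show sm: "summable (\<lambda>m. \<bar>weight \<alpha> k i m\<bar>)"
    using assms by (rule summable_abs_weight)
  note cont = continuous_on_weight_gf[OF sm]
  have "weight \<alpha> k i sums 0"
    unfolding sums_def using assms by (rule sum_weight_tendsto_0)
  then have "(\<lambda>m. complex_of_real (weight \<alpha> k i m)) sums 0"
    using sums_of_real[of "weight \<alpha> k i" 0] by simp
  then show "weight_gf \<alpha> k i 1 = 0"
    by (simp add: weight_gf_def sums_iff)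
  show "weight_gf \<alpha> k i \<xi> \<noteq> 0" if \<xi>: "cmod \<xi> \<le> 1 \<and> \<xi> \<noteq> 1" for \<xi>
  proof -
    \<comment> \<open>The points \<open>r n * \<xi>\<close> approach \<xi> radially inside the open
      disc, where \<open>ge\<close> applies. As \<xi> differs from 1, the quotient by 1 - \<xi> is
      continuous there and the bound survives in the limit.\<close>
    define r where "r n = 1 - 1 / real (n + 2)" for n
    have r: "0 \<le> r n" "r n < 1" for n by (auto simp: r_def)
    have "r \<longlonglongrightarrow> 1 - 0"
      unfolding r_def by (intro tendsto_diff tendsto_const lim_const_over_n
          LIMSEQ_ignore_initial_segment[of "\<lambda>n. 1 / real n" 0 2])
    then have "(\<lambda>n. of_real (r n) * \<xi>) \<longlonglongrightarrow> of_real 1 * \<xi>"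
      by (intro tendsto_mult tendsto_of_real) auto
    then have lim: "(\<lambda>n. of_real (r n) * \<xi>) \<longlonglongrightarrow> \<xi>" by simp
    have less: "cmod (of_real (r n) * \<xi>) < 1" for n
    proof -
      have "r n * cmod \<xi> \<le> r n" using \<xi> r[of n] by (simp add: mult_left_le)
      then show ?thesis using r[of n] by (simp add: norm_mult)
    qed
    have "(\<lambda>n. weight_gf \<alpha> k i (of_real (r n) * \<xi>)) \<longlonglongrightarrow> weight_gf \<alpha> k i \<xi>"
      using less \<xi> by (intro continuous_on_tendsto_compose[OF cont lim]) (auto intro!: always_eventually less_imp_le)
    then have "(\<lambda>n. Re (weight_gf \<alpha> k i (of_real (r n) * \<xi>) / (1 - of_real (r n) * \<xi>)))
        \<longlonglongrightarrow> Re (weight_gf \<alpha> k i \<xi> / (1 - \<xi>))"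
      using \<xi> by (intro tendsto_intros lim) auto
    then have "\<delta> \<le> Re (weight_gf \<alpha> k i \<xi> / (1 - \<xi>))"
      by (rule LIMSEQ_le_const) (use ge less in auto)
    then show ?thesis using \<delta> by auto
  qed
  show "\<not> (\<lambda>n. \<Sum>m\<le>n. weight \<alpha> k i m) sums 0"
  proof
    assume "(\<lambda>n. \<Sum>m\<le>n. weight \<alpha> k i m) sums 0"
    \<comment> \<open>At this real x the series of the phi_n equals \<open>weight_gf\<close> divided
      by 1 - x, so it would lie below \<delta> although \<open>ge\<close> puts it at or above
      \<delta>.\<close>
    from abel_sums_0[OF this \<delta>] obtain x where x: "0 < x" "x < 1"
      and less: "(\<Sum>n. (\<Sum>m\<le>n. weight \<alpha> k i m) * x ^ n) < \<delta>" by blast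
    have sx: "summable (\<lambda>n. \<bar>weight \<alpha> k i n * x ^ n\<bar>)"
      using sm by (rule summable_comparison_test'[where N = 0])
        (use x in \<open>simp add: abs_mult power_abs mult_left_le power_le_one\<close>)
    have "(\<lambda>n. weight \<alpha> k i n * x ^ n) sums (\<Sum>n. weight \<alpha> k i n * x ^ n)"
      by (rule summable_sums[OF summable_rabs_cancel[OF sx]])
    from sums_of_real[OF this, where ?'a = complex]
    have "weight_gf \<alpha> k i (of_real x) = of_real (\<Sum>n. weight \<alpha> k i n * x ^ n)"
      by (simp add: weight_gf_def sums_iff)
    then have "weight_gf \<alpha> k i (of_real x) / (1 - of_real x) = of_real ((\<Sum>n. weight \<alpha> k i n * x ^ n) / (1 - x))"
      by simp
    moreover have "(\<Sum>n. (\<Sum>m\<le>n. weight \<alpha> k i m) * x ^ n) = (\<Sum>n. weight \<alpha> k i n * x ^ n) / (1 - x)"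
      using partial_sums_gf[OF _ sx] x by (simp add: sums_iff)
    ultimately show False
      using ge[of "of_real x"] x less by (simp del: of_real_divide)
  qed
qed

end
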